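(* Let $\Sigma$ be a PA hypersurface with $(\mathcal V,\theta)$ in a Riemannian manifold $M$, where $\mathcal V$ is an anti-torqued vector field along $\Sigma$. (i) If $\theta=\frac{\pi}{2}$ identically, then the integral curves of the tangential component of $\mathcal V$ are geodesics of the ambient space $M$. Moreover, the shape operator $A$ of $\Sigma$ satisfies $\det(A)=0$. (ii) If $\theta=0$ identically, then $\Sigma$ is totally umbilical.
   Context: Let $\nabla$ be the Levi-Civita connection of $M$, and let $\mathfrak X(\Sigma)$ be the smooth vector fields tangent to $\Sigma$. A vector field along $\Sigma$ is a smooth section of $TM|_\Sigma$. An orientable hypersurface $\Sigma\subset M$ with unit normal field $\mathcal N$ is a prescribed angle (PA) hypersurface with $(\mathcal V,\theta)$ if $\mathcal V$ is a unit vector field along $\Sigma$, $\theta:\Sigma\to[0,\frac{\pi}{2}]$ is a smooth function, and $\langle\mathcal V,\mathcal N\rangle=\cos\theta$. The unit field $\mathcal V$ is anti-torqued along $\Sigma$ if there is a smooth function $f$ on $\Sigma$ (the potential function) with $\nabla_X\mathcal V=f\big(X-\langle X,\mathcal V\rangle\mathcal V\big)$ for all $X\in\mathfrak X(\Sigma)$. The tangential component $\mathcal T$ of $\mathcal V$ is defined by $\mathcal V=\mathcal T+\cos\theta\,\mathcal N$ with $\mathcal T\in\mathfrak X(\Sigma)$. The shape operator is $A(X)=-\nabla_X\mathcal N$. The hypersurface $\Sigma$ is totally umbilical if $A=\delta\,\mathrm{Id}$ for some smooth function $\delta$ on $\Sigma$. *)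

theory Defs
  imports "HOL-Analysis.Analysis"
begin

section \<open>Smooth maps between normed spaces\<close>

text \<open>
  \<^term>\<open>S\<close> is meant to be open and the domain finite-dimensional; the clause for \<^term>\<open>Suc k\<close> then says
  that all directional derivatives exist and are of class \<open>C^k\<close>.
\<close>

primrec Ck_on :: "nat \<Rightarrow> 'a::real_normed_vector set \<Rightarrow> ('a \<Rightarrow> 'b::real_normed_vector) \<Rightarrow> bool" where
  "Ck_on 0 S f \<longleftrightarrow> continuous_on S f"
| "Ck_on (Suc k) S f \<longleftrightarrow> (\<forall>x\<in>S. f differentiable (at x)) \<and>
      (\<forall>v. Ck_on k S (\<lambda>x. frechet_derivative f (at x) v))"

definition smooth_on :: "'a::real_normed_vector set \<Rightarrow> ('a \<Rightarrow> 'b::real_normed_vector) \<Rightarrow> bool" where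
  "smooth_on S f \<longleftrightarrow> (\<forall>k. Ck_on k S f)"

section \<open>Smooth manifolds\<close>

text \<open>A chart is a domain together with a coordinate map; values outside the domain are irrelevant.\<close>

type_synonym ('p, 'e) chart = "'p set \<times> ('p \<Rightarrow> 'e)"

abbreviation dom_of :: "('p, 'e) chart \<Rightarrow> 'p set" where
  "dom_of c \<equiv> fst c"

abbreviation coord :: "('p, 'e) chart \<Rightarrow> 'p \<Rightarrow> 'e" where
  "coord c \<equiv> snd c"

definition inv_coord :: "('p, 'e) chart \<Rightarrow> 'e \<Rightarrow> 'p" where
  "inv_coord c = inv_into (dom_of c) (coord c)"

record ('p, 'e) mfd =
  mtop :: "'p topology"
  atlas :: "('p, 'e) chart set"

abbreviation points :: "('p, 'e, 'z) mfd_scheme \<Rightarrow> 'p set" where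
  "points M \<equiv> topspace (mtop M)"

definition charts_at :: "('p, 'e, 'z) mfd_scheme \<Rightarrow> 'p \<Rightarrow> ('p, 'e) chart set" where
  "charts_at M p = {c \<in> atlas M. p \<in> dom_of c}"

definition smooth_manifold :: "('p, 'e::euclidean_space, 'z) mfd_scheme \<Rightarrow> bool" where
  "smooth_manifold M \<longleftrightarrow>
     Hausdorff_space (mtop M) \<and> second_countable (mtop M) \<and>
     (\<Union>c\<in>atlas M. dom_of c) = points M \<and>
     (\<forall>c\<in>atlas M. openin (mtop M) (dom_of c) \<and> open (coord c ` dom_of c) \<and>
        homeomorphic_map (subtopology (mtop M) (dom_of c)) (top_of_set (coord c ` dom_of c)) (coord c)) \<and>
     (\<forall>c\<in>atlas M. \<forall>d\<in>atlas M.
        smooth_on (coord c ` (dom_of c \<inter> dom_of d)) (coord d \<circ> inv_coord c))"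

text \<open>An arbitrary chart around \<^term>\<open>p\<close>; what is defined with it below does not depend on the choice.\<close>

definition some_chart :: "('p, 'e, 'z) mfd_scheme \<Rightarrow> 'p \<Rightarrow> ('p, 'e) chart" where
  "some_chart M p = (SOME c. c \<in> charts_at M p)"

text \<open>\<^term>\<open>U\<close> is meant to be an open set of points.\<close>

definition smooth_fun ::
  "('p, 'e::euclidean_space, 'z) mfd_scheme \<Rightarrow> 'p set \<Rightarrow> ('p \<Rightarrow> 'b::real_normed_vector) \<Rightarrow> bool" where
  "smooth_fun M U h \<longleftrightarrow>
     (\<forall>c\<in>atlas M. smooth_on (coord c ` (dom_of c \<inter> U)) (h \<circ> inv_coord c))"

definition smooth_map ::
  "('p, 'e::euclidean_space, 'y) mfd_scheme \<Rightarrow> ('q, 'f::euclidean_space, 'z) mfd_scheme \<Rightarrow> ('p \<Rightarrow> 'q) \<Rightarrow> bool" where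
  "smooth_map S M F \<longleftrightarrow> continuous_map (mtop S) (mtop M) F \<and>
     (\<forall>c\<in>atlas M. smooth_fun S {p \<in> points S. F p \<in> dom_of c} (coord c \<circ> F))"

section \<open>Tangent vectors and vector fields along maps\<close>

text \<open>
  A tangent vector at \<open>p\<close> is the family of its component vectors in all charts around \<open>p\<close>, the
  components in different charts being related by the derivative of the change of coordinates. Families
  are \<open>0\<close> at everything that is not a chart around \<open>p\<close>, so that equal vectors are equal functions.
  The vector space operations are computed chartwise.
\<close>

type_synonym ('p, 'e) tangent = "('p, 'e) chart \<Rightarrow> 'e"

definition transition_deriv :: "('p, 'e::euclidean_space) chart \<Rightarrow> ('p, 'e) chart \<Rightarrow> 'p \<Rightarrow> 'e \<Rightarrow> 'e" where
  "transition_deriv c d p = frechet_derivative (coord d \<circ> inv_coord c) (at (coord c p))"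

definition tangent_space :: "('p, 'e::euclidean_space, 'z) mfd_scheme \<Rightarrow> 'p \<Rightarrow> ('p, 'e) tangent set" where
  "tangent_space M p = {v.
     (\<forall>c\<in>charts_at M p. \<forall>d\<in>charts_at M p. v d = transition_deriv c d p (v c)) \<and>
     (\<forall>c. c \<notin> charts_at M p \<longrightarrow> v c = 0)}"

text \<open>The tangent vector at \<^term>\<open>p\<close> with component vector \<^term>\<open>u\<close> in the chart \<^term>\<open>c\<close>.\<close>

definition tangent_of ::
  "('p, 'e::euclidean_space, 'z) mfd_scheme \<Rightarrow> 'p \<Rightarrow> ('p, 'e) chart \<Rightarrow> 'e \<Rightarrow> ('p, 'e) tangent" where
  "tangent_of M p c u = (\<lambda>d. if d \<in> charts_at M p then transition_deriv c d p u else 0)"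

definition dir_deriv ::
  "('p, 'e::euclidean_space, 'z) mfd_scheme \<Rightarrow> 'p \<Rightarrow> ('p, 'e) tangent \<Rightarrow>
     ('p \<Rightarrow> 'b::real_normed_vector) \<Rightarrow> 'b" where
  "dir_deriv M p v h =
     (let c = some_chart M p in frechet_derivative (h \<circ> inv_coord c) (at (coord c p)) (v c))"

text \<open>The differential of \<^term>\<open>F\<close> at \<^term>\<open>p\<close>.\<close>

definition differential ::
  "('p, 'e::euclidean_space, 'y) mfd_scheme \<Rightarrow> ('q, 'f::euclidean_space, 'z) mfd_scheme \<Rightarrow> ('p \<Rightarrow> 'q) \<Rightarrow>
     'p \<Rightarrow> ('p, 'e) tangent \<Rightarrow> ('q, 'f) tangent" where
  "differential S M F p v =
     (\<lambda>c. if c \<in> charts_at M (F p) then dir_deriv S p v (coord c \<circ> F) else 0)"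

definition vector_field_along ::
  "('p, 'e::euclidean_space, 'y) mfd_scheme \<Rightarrow> ('q, 'f::euclidean_space, 'z) mfd_scheme \<Rightarrow> ('p \<Rightarrow> 'q) \<Rightarrow>
     ('p \<Rightarrow> ('q, 'f) tangent) \<Rightarrow> bool" where
  "vector_field_along S M F V \<longleftrightarrow>
     (\<forall>p\<in>points S. V p \<in> tangent_space M (F p)) \<and>
     (\<forall>c\<in>atlas M. smooth_fun S {p \<in> points S. F p \<in> dom_of c} (\<lambda>p. V p c))"

abbreviation vector_field ::
  "('p, 'e::euclidean_space, 'z) mfd_scheme \<Rightarrow> ('p \<Rightarrow> ('p, 'e) tangent) \<Rightarrow> bool" where
  "vector_field M X \<equiv> vector_field_along M M id X"

definition lie_bracket ::
  "('p, 'e::euclidean_space, 'z) mfd_scheme \<Rightarrow> ('p \<Rightarrow> ('p, 'e) tangent) \<Rightarrow> ('p \<Rightarrow> ('p, 'e) tangent) \<Rightarrow>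
     'p \<Rightarrow> ('p, 'e) tangent" where
  "lie_bracket M X Y p = (\<lambda>c. if c \<in> charts_at M p
     then dir_deriv M p (X p) (\<lambda>q. Y q c) - dir_deriv M p (Y p) (\<lambda>q. X q c) else 0)"

section \<open>Riemannian manifolds and the Levi-Civita connection\<close>

text \<open>\<open>gcomp M c p\<close> is the metric tensor at \<open>p\<close> as a bilinear form on components in the chart \<open>c\<close>.\<close>

record ('p, 'e) riem_mfd = "('p, 'e) mfd" +
  gcomp :: "('p, 'e) chart \<Rightarrow> 'p \<Rightarrow> 'e \<Rightarrow> 'e \<Rightarrow> real"

definition riemannian_manifold :: "('p, 'e::euclidean_space) riem_mfd \<Rightarrow> bool" where
  "riemannian_manifold M \<longleftrightarrow> smooth_manifold M \<and>
     (\<forall>c\<in>atlas M. \<forall>p\<in>dom_of c. bilinear (gcomp M c p) \<and>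
        (\<forall>u v. gcomp M c p u v = gcomp M c p v u) \<and> (\<forall>u. u \<noteq> 0 \<longrightarrow> gcomp M c p u u > 0)) \<and>
     (\<forall>c\<in>atlas M. \<forall>u v. smooth_fun M (dom_of c) (\<lambda>p. gcomp M c p u v)) \<and>
     (\<forall>c\<in>atlas M. \<forall>d\<in>atlas M. \<forall>p\<in>dom_of c \<inter> dom_of d. \<forall>u v.
        gcomp M d p (transition_deriv c d p u) (transition_deriv c d p v) = gcomp M c p u v)"

definition ip :: "('p, 'e::euclidean_space) riem_mfd \<Rightarrow> 'p \<Rightarrow> ('p, 'e) tangent \<Rightarrow> ('p, 'e) tangent \<Rightarrow> real" where
  "ip M p v w = (let c = some_chart M p in gcomp M c p (v c) (w c))"

text \<open>
  A connection on the tangent bundle, given by its Christoffel symbols: \<open>\<Gamma> c p u v\<close> is the component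
  vector in the chart \<open>c\<close> of the covariant derivative, at \<open>p\<close> and in direction \<open>u\<close>, of the vector field
  with constant components \<open>v\<close>. The last clause is the transformation law of Christoffel symbols under
  a change of coordinates \<open>\<tau>\<close>, namely
  \<open>\<Gamma>'(D\<tau> u, D\<tau> v) = D\<tau>(\<Gamma>(u, v)) - D\<^sup>2\<tau>(u, v)\<close>.
\<close>

type_synonym ('p, 'e) christoffel = "('p, 'e) chart \<Rightarrow> 'p \<Rightarrow> 'e \<Rightarrow> 'e \<Rightarrow> 'e"

definition connection :: "('p, 'e::euclidean_space, 'z) mfd_scheme \<Rightarrow> ('p, 'e) christoffel \<Rightarrow> bool" where
  "connection M \<Gamma> \<longleftrightarrow>
     (\<forall>c\<in>atlas M. \<forall>p\<in>dom_of c. bilinear (\<Gamma> c p)) \<and>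
     (\<forall>c\<in>atlas M. \<forall>u v. smooth_fun M (dom_of c) (\<lambda>p. \<Gamma> c p u v)) \<and>
     (\<forall>c\<in>atlas M. \<forall>d\<in>atlas M. \<forall>p\<in>dom_of c \<inter> dom_of d. \<forall>u v.
        \<Gamma> d p (transition_deriv c d p u) (transition_deriv c d p v) =
          transition_deriv c d p (\<Gamma> c p u v) -
          frechet_derivative (\<lambda>x. frechet_derivative (coord d \<circ> inv_coord c) (at x) v) (at (coord c p)) u)"

text \<open>
  The covariant derivative, in direction \<^term>\<open>v\<close> tangent to \<^term>\<open>S\<close> at \<^term>\<open>p\<close>, of a vector field
  \<^term>\<open>V\<close> along \<open>F : S \<rightarrow> M\<close>, with respect to the connection of \<open>M\<close>.
\<close>

definition cov_deriv ::
  "('p, 'e::euclidean_space, 'y) mfd_scheme \<Rightarrow> ('q, 'f::euclidean_space, 'z) mfd_scheme \<Rightarrow>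
     ('q, 'f) christoffel \<Rightarrow> ('p \<Rightarrow> 'q) \<Rightarrow> 'p \<Rightarrow> ('p, 'e) tangent \<Rightarrow> ('p \<Rightarrow> ('q, 'f) tangent) \<Rightarrow> ('q, 'f) tangent" where
  "cov_deriv S M \<Gamma> F p v V = (\<lambda>c. if c \<in> charts_at M (F p)
     then dir_deriv S p v (\<lambda>q. V q c) + \<Gamma> c (F p) (differential S M F p v c) (V p c) else 0)"

definition torsion_free :: "('p, 'e::euclidean_space) riem_mfd \<Rightarrow> ('p, 'e) christoffel \<Rightarrow> bool" where
  "torsion_free M \<Gamma> \<longleftrightarrow>
     (\<forall>X Y. vector_field M X \<longrightarrow> vector_field M Y \<longrightarrow> (\<forall>p\<in>points M.
        (\<lambda>c. cov_deriv M M \<Gamma> id p (X p) Y c - cov_deriv M M \<Gamma> id p (Y p) X c) = lie_bracket M X Y p))"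

definition metric_compatible :: "('p, 'e::euclidean_space) riem_mfd \<Rightarrow> ('p, 'e) christoffel \<Rightarrow> bool" where
  "metric_compatible M \<Gamma> \<longleftrightarrow>
     (\<forall>X Y Z. vector_field M X \<longrightarrow> vector_field M Y \<longrightarrow> vector_field M Z \<longrightarrow> (\<forall>p\<in>points M.
        dir_deriv M p (X p) (\<lambda>q. ip M q (Y q) (Z q)) =
          ip M p (cov_deriv M M \<Gamma> id p (X p) Y) (Z p) + ip M p (Y p) (cov_deriv M M \<Gamma> id p (X p) Z)))"

definition levi_civita :: "('p, 'e::euclidean_space) riem_mfd \<Rightarrow> ('p, 'e) christoffel \<Rightarrow> bool" where
  "levi_civita M \<Gamma> \<longleftrightarrow> connection M \<Gamma> \<and> torsion_free M \<Gamma> \<and> metric_compatible M \<Gamma>"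

section \<open>Curves\<close>

text \<open>Curves are smooth and parametrised by an open interval.\<close>

definition smooth_curve :: "('p, 'e::euclidean_space, 'z) mfd_scheme \<Rightarrow> real set \<Rightarrow> (real \<Rightarrow> 'p) \<Rightarrow> bool" where
  "smooth_curve M I \<gamma> \<longleftrightarrow> open I \<and> is_interval I \<and> continuous_map (top_of_set I) (mtop M) \<gamma> \<and>
     (\<forall>c\<in>atlas M. smooth_on {t \<in> I. \<gamma> t \<in> dom_of c} (coord c \<circ> \<gamma>))"

definition velocity ::
  "('p, 'e::euclidean_space, 'z) mfd_scheme \<Rightarrow> (real \<Rightarrow> 'p) \<Rightarrow> real \<Rightarrow> ('p, 'e) tangent" where
  "velocity M \<gamma> t =
     (\<lambda>c. if c \<in> charts_at M (\<gamma> t) then vector_derivative (coord c \<circ> \<gamma>) (at t) else 0)"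

definition integral_curve ::
  "('p, 'e::euclidean_space, 'z) mfd_scheme \<Rightarrow> ('p \<Rightarrow> ('p, 'e) tangent) \<Rightarrow> real set \<Rightarrow> (real \<Rightarrow> 'p) \<Rightarrow> bool" where
  "integral_curve M X I \<gamma> \<longleftrightarrow> smooth_curve M I \<gamma> \<and> (\<forall>t\<in>I. velocity M \<gamma> t = X (\<gamma> t))"

text \<open>The covariant derivative of the velocity field along the curve itself.\<close>

definition acceleration ::
  "('p, 'e::euclidean_space, 'z) mfd_scheme \<Rightarrow> ('p, 'e) christoffel \<Rightarrow> (real \<Rightarrow> 'p) \<Rightarrow> real \<Rightarrow> ('p, 'e) tangent" where
  "acceleration M \<Gamma> \<gamma> t = (\<lambda>c. if c \<in> charts_at M (\<gamma> t)
     then vector_derivative (\<lambda>s. velocity M \<gamma> s c) (at t) +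
          \<Gamma> c (\<gamma> t) (velocity M \<gamma> t c) (velocity M \<gamma> t c) else 0)"

definition geodesic ::
  "('p, 'e::euclidean_space, 'z) mfd_scheme \<Rightarrow> ('p, 'e) christoffel \<Rightarrow> real set \<Rightarrow> (real \<Rightarrow> 'p) \<Rightarrow> bool" where
  "geodesic M \<Gamma> I \<gamma> \<longleftrightarrow> smooth_curve M I \<gamma> \<and> (\<forall>t\<in>I. \<forall>c. acceleration M \<Gamma> \<gamma> t c = 0)"

section \<open>Hypersurfaces\<close>

text \<open>
  A hypersurface is given by an immersion \<^term>\<open>F\<close> of codimension one; a hypersurface that is a subset
  of \<^term>\<open>M\<close> is the case where \<^term>\<open>F\<close> is the inclusion.
\<close>

definition hypersurface ::
  "('s, 'k::euclidean_space) mfd \<Rightarrow> ('m, 'e::euclidean_space) riem_mfd \<Rightarrow> ('s \<Rightarrow> 'm) \<Rightarrow> bool" where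
  "hypersurface S M F \<longleftrightarrow> smooth_manifold S \<and> smooth_map S M F \<and> DIM('e) = DIM('k) + 1 \<and>
     (\<forall>p\<in>points S. inj_on (differential S M F p) (tangent_space S p))"

definition unit_field_along ::
  "('s, 'k::euclidean_space) mfd \<Rightarrow> ('m, 'e::euclidean_space) riem_mfd \<Rightarrow> ('s \<Rightarrow> 'm) \<Rightarrow>
     ('s \<Rightarrow> ('m, 'e) tangent) \<Rightarrow> bool" where
  "unit_field_along S M F V \<longleftrightarrow>
     vector_field_along S M F V \<and> (\<forall>p\<in>points S. ip M (F p) (V p) (V p) = 1)"

text \<open>The existence of such a (global) field is the orientability of the hypersurface.\<close>

definition unit_normal ::
  "('s, 'k::euclidean_space) mfd \<Rightarrow> ('m, 'e::euclidean_space) riem_mfd \<Rightarrow> ('s \<Rightarrow> 'm) \<Rightarrow>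
     ('s \<Rightarrow> ('m, 'e) tangent) \<Rightarrow> bool" where
  "unit_normal S M F N \<longleftrightarrow> unit_field_along S M F N \<and>
     (\<forall>p\<in>points S. \<forall>v\<in>tangent_space S p. ip M (F p) (N p) (differential S M F p v) = 0)"

definition pa_hypersurface ::
  "('s, 'k::euclidean_space) mfd \<Rightarrow> ('m, 'e::euclidean_space) riem_mfd \<Rightarrow> ('s \<Rightarrow> 'm) \<Rightarrow>
     ('s \<Rightarrow> ('m, 'e) tangent) \<Rightarrow> ('s \<Rightarrow> ('m, 'e) tangent) \<Rightarrow> ('s \<Rightarrow> real) \<Rightarrow> bool" where
  "pa_hypersurface S M F N V \<theta> \<longleftrightarrow>
     hypersurface S M F \<and> unit_normal S M F N \<and> unit_field_along S M F V \<and>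
     smooth_fun S (points S) \<theta> \<and> (\<forall>p\<in>points S. \<theta> p \<in> {0..pi / 2}) \<and>
     (\<forall>p\<in>points S. ip M (F p) (V p) (N p) = cos (\<theta> p))"

text \<open>A vector field \<^term>\<open>X\<close> tangent to the hypersurface lives on \<^term>\<open>S\<close>; in \<^term>\<open>M\<close> it is its image
  under the differential of \<^term>\<open>F\<close>.\<close>

definition anti_torqued ::
  "('s, 'k::euclidean_space) mfd \<Rightarrow> ('m, 'e::euclidean_space) riem_mfd \<Rightarrow> ('m, 'e) christoffel \<Rightarrow>
     ('s \<Rightarrow> 'm) \<Rightarrow> ('s \<Rightarrow> ('m, 'e) tangent) \<Rightarrow> bool" where
  "anti_torqued S M \<Gamma> F V \<longleftrightarrow> unit_field_along S M F V \<and>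
     (\<exists>f. smooth_fun S (points S) f \<and>
        (\<forall>X. vector_field S X \<longrightarrow> (\<forall>p\<in>points S.
           cov_deriv S M \<Gamma> F p (X p) V =
             (let Y = differential S M F p (X p)
              in (\<lambda>c. f p *\<^sub>R (Y c - ip M (F p) Y (V p) *\<^sub>R V p c))))))"

definition tangential_part ::
  "('s, 'k::euclidean_space) mfd \<Rightarrow> ('m, 'e::euclidean_space) riem_mfd \<Rightarrow> ('s \<Rightarrow> 'm) \<Rightarrow>
     ('s \<Rightarrow> ('m, 'e) tangent) \<Rightarrow> ('s \<Rightarrow> ('m, 'e) tangent) \<Rightarrow> ('s \<Rightarrow> real) \<Rightarrow> 's \<Rightarrow> ('s, 'k) tangent" where
  "tangential_part S M F N V \<theta> p = (THE w. w \<in> tangent_space S p \<and>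
     V p = (\<lambda>c. differential S M F p w c + cos (\<theta> p) *\<^sub>R N p c))"

text \<open>The shape operator at \<^term>\<open>p\<close> as an endomorphism of the tangent space of \<^term>\<open>S\<close>.\<close>

definition shape_operator ::
  "('s, 'k::euclidean_space) mfd \<Rightarrow> ('m, 'e::euclidean_space) riem_mfd \<Rightarrow> ('m, 'e) christoffel \<Rightarrow>
     ('s \<Rightarrow> 'm) \<Rightarrow> ('s \<Rightarrow> ('m, 'e) tangent) \<Rightarrow> 's \<Rightarrow> ('s, 'k) tangent \<Rightarrow> ('s, 'k) tangent" where
  "shape_operator S M \<Gamma> F N p v = (THE w. w \<in> tangent_space S p \<and>
     differential S M F p w = (\<lambda>c. - cov_deriv S M \<Gamma> F p v N c))"

definition totally_umbilical ::
  "('s, 'k::euclidean_space) mfd \<Rightarrow> ('m, 'e::euclidean_space) riem_mfd \<Rightarrow> ('m, 'e) christoffel \<Rightarrow>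
     ('s \<Rightarrow> 'm) \<Rightarrow> ('s \<Rightarrow> ('m, 'e) tangent) \<Rightarrow> bool" where
  "totally_umbilical S M \<Gamma> F N \<longleftrightarrow> (\<exists>\<delta>. smooth_fun S (points S) \<delta> \<and>
     (\<forall>p\<in>points S. \<forall>v\<in>tangent_space S p. shape_operator S M \<Gamma> F N p v = (\<lambda>c. \<delta> p *\<^sub>R v c)))"

text \<open>
  The determinant of an endomorphism of the tangent space at \<^term>\<open>p\<close>: that of its matrix with respect
  to the basis of coordinate vectors of a chart.
\<close>

definition tangent_det ::
  "('s, real ^ 'n) mfd \<Rightarrow> 's \<Rightarrow> (('s, real ^ 'n) tangent \<Rightarrow> ('s, real ^ 'n) tangent) \<Rightarrow> real" where
  "tangent_det S p A =
     (let c = some_chart S p in det (matrix (\<lambda>u. A (tangent_of S p c u) c)))"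

end

theory Submission
  imports Defs
begin

text \<open>
  Write \<open>\<langle>_, _\<rangle>\<close> for the metric of \<open>M\<close>, \<open>\<nabla>\<close> for its connection, \<open>A\<close> for the shape operator and \<open>f\<close> for
  the potential function of \<open>V\<close>.

  If \<open>\<theta> = \<pi>/2\<close>, then \<open>V\<close> is tangent to the hypersurface and equals its tangential component \<open>T\<close>. Hence
  \<open>\<nabla>\<^sub>T V = f (V - \<langle>V, V\<rangle> V) = 0\<close>, because \<open>V\<close> has length one, and along an integral curve of \<open>T\<close> the
  field \<open>V\<close> is the velocity of the curve in \<open>M\<close> (lemma \<open>acceleration_compose\<close>): the curve is a
  geodesic. Moreover \<open>\<nabla>\<^sub>v V\<close> is tangent to the hypersurface for every tangent vector \<open>v\<close>, so
  differentiating \<open>\<langle>V, N\<rangle> = 0\<close> gives \<open>\<langle>A v, V\<rangle> = - \<langle>\<nabla>\<^sub>v N, V\<rangle> = \<langle>\<nabla>\<^sub>v V, N\<rangle> = 0\<close>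
  (lemma \<open>shape_operator_orthogonal\<close>). The range of \<open>A\<close> is thus orthogonal to the nonzero tangent
  vector \<open>V\<close>, and \<open>A\<close> is singular.

  If \<open>\<theta> = 0\<close>, then \<open>V\<close> and \<open>N\<close> are unit vectors with \<open>\<langle>V, N\<rangle> = 1\<close>, so \<open>V = N\<close> and
  \<open>A v = - \<nabla>\<^sub>v V = - f (v - \<langle>v, N\<rangle> N) = - f v\<close>.

  The work lies in justifying these computations in charts. The hypotheses on \<open>V\<close> and on the
  connection are stated for global vector fields and are used at single tangent vectors, which
  requires the extension of tangent vectors by means of a smooth bump function
  (lemma \<open>exists_vector_field_extending\<close>). Differentiation of inner products of fields that exist only
  along the immersion is reduced to Ricci's identity for the metric tensor
  (lemma \<open>metric_compatible_along\<close>). Finally, for the shape operator to be meaningful, \<open>\<nabla>\<^sub>v N\<close> must be a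
  tangent vector of \<open>M\<close>, independent of charts (lemma \<open>cov_deriv_in_tangent_space\<close>), and lie in the
  image of the differential of the immersion (lemma \<open>orthogonal_to_normal_is_tangential\<close>).
\<close>

section \<open>Calculus of smooth functions\<close>

lemma differentiable_transform_open:
  assumes "f differentiable (at x)" "open S" "x \<in> S" "\<And>y. y \<in> S \<Longrightarrow> f y = g y"
  shows "g differentiable (at x)"
    and "frechet_derivative g (at x) = frechet_derivative f (at x)"
proof -
  have "(f has_derivative frechet_derivative f (at x)) (at x)"
    using assms(1) frechet_derivative_works by blast
  hence *: "(g has_derivative frechet_derivative f (at x)) (at x)"
    by (rule has_derivative_transform_within_open[OF _ assms(2,3)]) (use assms(4) in auto)
  show "g differentiable (at x)" using * by (auto simp: differentiable_def)
  show "frechet_derivative g (at x) = frechet_derivative f (at x)"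
    using frechet_derivative_at[OF *] by simp
qed

lemma Ck_on_cong:
  assumes "open S" "\<And>x. x \<in> S \<Longrightarrow> f x = g x" "Ck_on k S f"
  shows "Ck_on k S g"
  using assms(2,3)
proof (induction k arbitrary: f g)
  case 0
  then show ?case using continuous_on_cong by force
next
  case (Suc k)
  have d: "f differentiable (at x)" if "x \<in> S" for x using Suc.prems that by auto
  note tr = differentiable_transform_open[OF d assms(1) _ Suc.prems(1)]
  have "Ck_on k S (\<lambda>x. frechet_derivative g (at x) v)" for v
    by (rule Suc.IH[of "\<lambda>x. frechet_derivative f (at x) v"]) (use tr Suc.prems in auto)
  with tr show ?case by auto
qed

lemma Ck_on_subset: "Ck_on k S f \<Longrightarrow> T \<subseteq> S \<Longrightarrow> Ck_on k T f"
  by (induction k arbitrary: f) (auto intro: continuous_on_subset)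

text \<open>Differentiability classes are local. This is what allows functions on a manifold that are given by
  different formulas on different charts, or by zero off a compact set, to be handled piece by piece.\<close>

lemma Ck_on_local:
  assumes "\<And>x. x \<in> S \<Longrightarrow> \<exists>U. open U \<and> x \<in> U \<and> Ck_on k U f"
  shows "Ck_on k S f"
  using assms
proof (induction k arbitrary: f)
  case 0
  show ?case unfolding Ck_on.simps
  proof (rule continuous_at_imp_continuous_on, rule)
    fix x assume x: "x \<in> S"
    obtain U where "open U" "x \<in> U" "continuous_on U f" using 0[OF x] by auto
    thus "isCont f x" by (simp add: continuous_on_eq_continuous_at)
  qed
next
  case (Suc k)
  have "f differentiable (at x)" if x: "x \<in> S" for x
    using Suc.prems[OF x] by auto
  moreover have "Ck_on k S (\<lambda>x. frechet_derivative f (at x) v)" for v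
  proof (rule Suc.IH)
    fix x assume "x \<in> S"
    from Suc.prems[OF this] show "\<exists>U. open U \<and> x \<in> U \<and> Ck_on k U (\<lambda>x. frechet_derivative f (at x) v)"
      by auto
  qed
  ultimately show ?case by simp
qed

lemma Ck_on_Suc_imp: "Ck_on (Suc k) S f \<Longrightarrow> Ck_on k S f"
proof (induction k arbitrary: f)
  case 0
  then show ?case
    by (auto intro!: continuous_at_imp_continuous_on differentiable_imp_continuous_within)
next
  case (Suc k)
  then show ?case by (metis Ck_on.simps(2))
qed

text \<open>Any family of derivatives may serve, because derivatives are unique; it need not be presented
  through \<^const>\<open>frechet_derivative\<close>.\<close>

lemma Ck_on_SucI:
  assumes "open S" "\<And>x. x \<in> S \<Longrightarrow> (f has_derivative f' x) (at x)" "\<And>v. Ck_on k S (\<lambda>x. f' x v)"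
  shows "Ck_on (Suc k) S f"
proof -
  have "frechet_derivative f (at x) = f' x" if "x \<in> S" for x
    using frechet_derivative_at[OF assms(2)[OF that]] by simp
  hence "Ck_on k S (\<lambda>x. frechet_derivative f (at x) v)" for v
    by (intro Ck_on_cong[OF assms(1) _ assms(3)[of v]]) auto
  with assms(2) show ?thesis by (auto simp: differentiable_def)
qed

lemma Ck_on_SucD:
  assumes "Ck_on (Suc k) S f"
  shows "x \<in> S \<Longrightarrow> (f has_derivative frechet_derivative f (at x)) (at x)"
    and "Ck_on k S (\<lambda>x. frechet_derivative f (at x) v)"
  using assms frechet_derivative_works by auto

lemma Ck_on_const: "open S \<Longrightarrow> Ck_on k S (\<lambda>x. c)"
proof (induction k arbitrary: c)
  case (Suc k)
  show ?case
    by (rule Ck_on_SucI[where f' = "\<lambda>_ _. 0"]) (use Suc in auto)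
qed auto

lemma Ck_on_bounded_linear:
  assumes "bounded_linear L" "open S"
  shows "Ck_on k S L"
proof (cases k)
  case 0
  then show ?thesis using assms by (simp add: linear_continuous_on)
next
  case (Suc m)
  show ?thesis unfolding Suc
    by (rule Ck_on_SucI[where f' = "\<lambda>_. L"])
       (use assms in \<open>auto intro: Ck_on_const bounded_linear_imp_has_derivative\<close>)
qed

lemma Ck_on_add:
  assumes "open S" "Ck_on k S f" "Ck_on k S g"
  shows "Ck_on k S (\<lambda>x. f x + g x)"
  using assms(2,3)
proof (induction k arbitrary: f g)
  case 0
  then show ?case by (auto intro: continuous_on_add)
next
  case (Suc k)
  show ?case
    by (rule Ck_on_SucI[OF assms(1)
          has_derivative_add[OF Ck_on_SucD(1)[OF Suc.prems(1)] Ck_on_SucD(1)[OF Suc.prems(2)]]])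
       (auto intro!: Suc.IH Ck_on_SucD(2)[OF Suc.prems(1)] Ck_on_SucD(2)[OF Suc.prems(2)])
qed

lemma Ck_on_sum:
  assumes "open S" "\<And>i. i \<in> I \<Longrightarrow> Ck_on k S (f i)"
  shows "Ck_on k S (\<lambda>x. \<Sum>i\<in>I. f i x)"
  using assms(2)
  by (induction I rule: infinite_finite_induct) (auto intro!: Ck_on_const Ck_on_add assms(1))

lemma Ck_on_linear_compose:
  assumes "bounded_linear L" "open S" "Ck_on k S f"
  shows "Ck_on k S (\<lambda>x. L (f x))"
  using assms(3)
proof (induction k arbitrary: f)
  case 0
  then show ?case using assms(1) by (auto intro: bounded_linear.continuous_on)
next
  case (Suc k)
  show ?case
    by (rule Ck_on_SucI[OF assms(2) bounded_linear.has_derivative[OF assms(1) Ck_on_SucD(1)[OF Suc.prems]]])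
       (auto intro!: Suc.IH Ck_on_SucD(2)[OF Suc.prems])
qed

text \<open>By the Leibniz rule the derivative is a sum of products of functions that are one class less
  smooth, so the induction hypothesis has to cover arbitrary factors.\<close>

lemma Ck_on_bilinear:
  assumes "bounded_bilinear B" "open S" "Ck_on k S f" "Ck_on k S g"
  shows "Ck_on k S (\<lambda>x. B (f x) (g x))"
  using assms(3,4)
proof (induction k arbitrary: f g)
  case 0
  then show ?case using assms(1) by (auto intro: bounded_bilinear.continuous_on)
next
  case (Suc k)
  show ?case
    by (rule Ck_on_SucI[OF assms(2) bounded_bilinear.FDERIV[OF assms(1)
           Ck_on_SucD(1)[OF Suc.prems(1)] Ck_on_SucD(1)[OF Suc.prems(2)]]])
       (auto intro!: Ck_on_add assms(2) Suc.IH Ck_on_SucD(2)[OF Suc.prems(1)] Ck_on_SucD(2)[OF Suc.prems(2)]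
         Ck_on_Suc_imp[OF Suc.prems(1)] Ck_on_Suc_imp[OF Suc.prems(2)])
qed

text \<open>In the chain rule the derivative of the outer map is taken in a direction that varies with the
  point. Expanding that direction in a basis leaves only derivatives in fixed directions, which is
  what the definition of \<^const>\<open>Ck_on\<close> speaks of.\<close>

lemma Ck_on_compose:
  fixes f :: "'a::real_normed_vector \<Rightarrow> 'b::euclidean_space"
    and g :: "'b \<Rightarrow> 'c::real_normed_vector"
  assumes "open S" "f ` S \<subseteq> T" "Ck_on k S f" "Ck_on k T g"
  shows "Ck_on k S (g \<circ> f)"
  using assms(3,4)
proof (induction k arbitrary: g)
  case 0
  then show ?case using assms(2) by (auto simp: o_def intro: continuous_on_compose2)
next
  case (Suc k)
  let ?f' = "\<lambda>x. frechet_derivative f (at x)"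
  let ?g' = "\<lambda>y. frechet_derivative g (at y)"
  let ?D = "\<lambda>x v. \<Sum>b\<in>Basis. (?f' x v \<bullet> b) *\<^sub>R ?g' (f x) b"
  have fk: "Ck_on k S f" using Suc.prems(1) by (rule Ck_on_Suc_imp)
  show ?case
  proof (rule Ck_on_SucI[OF assms(1), where f' = ?D])
    fix x assume x: "x \<in> S"
    hence g: "(g has_derivative ?g' (f x)) (at (f x))"
      using Ck_on_SucD(1)[OF Suc.prems(2)] assms(2) by blast
    have eq: "?g' (f x) (?f' x v) = ?D x v" for v
    proof -
      have "?g' (f x) (?f' x v) = ?g' (f x) (\<Sum>b\<in>Basis. (?f' x v \<bullet> b) *\<^sub>R b)"
        by (simp add: euclidean_representation)
      also have "\<dots> = ?D x v"
        using has_derivative_linear[OF g] by (simp add: linear_sum linear_scale)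
      finally show ?thesis .
    qed
    have "(g \<circ> f has_derivative (\<lambda>v. ?g' (f x) (?f' x v))) (at x)"
      using diff_chain_at[OF Ck_on_SucD(1)[OF Suc.prems(1) x] g] by (simp add: o_def)
    thus "(g \<circ> f has_derivative ?D x) (at x)" by (simp add: eq)
  next
    fix v
    have "Ck_on k S (\<lambda>x. (?f' x v \<bullet> b) *\<^sub>R ?g' (f x) b)" for b
    proof (rule Ck_on_bilinear[OF bounded_bilinear_scaleR assms(1)])
      show "Ck_on k S (\<lambda>x. ?f' x v \<bullet> b)"
        by (rule Ck_on_linear_compose[OF bounded_linear_inner_left assms(1)
              Ck_on_SucD(2)[OF Suc.prems(1)]])
      show "Ck_on k S (\<lambda>x. ?g' (f x) b)"
        using Suc.IH[OF fk Ck_on_SucD(2)[OF Suc.prems(2), of b]] by (simp add: o_def)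
    qed
    thus "Ck_on k S (\<lambda>x. ?D x v)" by (intro Ck_on_sum assms(1))
  qed
qed

lemma smooth_on_compose:
  fixes f :: "'a::real_normed_vector \<Rightarrow> 'b::euclidean_space"
  assumes "smooth_on S f" "smooth_on T g" "open S" "f ` S \<subseteq> T"
  shows "smooth_on S (g \<circ> f)"
  using Ck_on_compose[OF assms(3,4)] assms(1,2) by (auto simp: smooth_on_def)

lemma smooth_on_cong:
  "open S \<Longrightarrow> smooth_on S f \<Longrightarrow> (\<And>x. x \<in> S \<Longrightarrow> f x = g x) \<Longrightarrow> smooth_on S g"
  unfolding smooth_on_def by (auto intro: Ck_on_cong[of S f g])

lemma smooth_on_subset: "smooth_on S f \<Longrightarrow> T \<subseteq> S \<Longrightarrow> smooth_on T f"
  using Ck_on_subset[of _ S f T] by (auto simp: smooth_on_def)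

lemma smooth_on_local:
  assumes "\<And>x. x \<in> S \<Longrightarrow> \<exists>U. open U \<and> x \<in> U \<and> smooth_on U f"
  shows "smooth_on S f"
  unfolding smooth_on_def
proof
  fix k
  show "Ck_on k S f" by (rule Ck_on_local) (use assms in \<open>auto simp: smooth_on_def\<close>)
qed

lemma smooth_on_const: "open S \<Longrightarrow> smooth_on S (\<lambda>x. c)"
  by (simp add: smooth_on_def Ck_on_const)

lemma smooth_on_scaleR:
  "open S \<Longrightarrow> smooth_on S f \<Longrightarrow> smooth_on S g \<Longrightarrow> smooth_on S (\<lambda>x. f x *\<^sub>R g x)"
  by (simp add: smooth_on_def Ck_on_bilinear[OF bounded_bilinear_scaleR])

lemma smooth_on_frechet_derivative:
  "smooth_on S f \<Longrightarrow> smooth_on S (\<lambda>x. frechet_derivative f (at x) v)"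
  unfolding smooth_on_def using Ck_on_SucD(2)[of _ S f v] by simp

lemma smooth_on_has_derivative:
  "smooth_on S f \<Longrightarrow> x \<in> S \<Longrightarrow> (f has_derivative frechet_derivative f (at x)) (at x)"
  unfolding smooth_on_def using Ck_on_SucD(1)[of 0 S f x] by blast

section \<open>A smooth bump function\<close>

text \<open>Every derivative of \<open>exp (- 1 / x)\<close>, continued by zero to the left, is a polynomial in \<open>1 / x\<close> times
  the function itself. With the polynomial as a parameter the family is closed under differentiation,
  and smoothness becomes an induction.\<close>

definition flat_fun :: "real poly \<Rightarrow> real \<Rightarrow> real" where
  "flat_fun p x = (if 0 < x then poly p (1 / x) * exp (- (1 / x)) else 0)"

lemma poly_times_exp_minus_tendsto_0: "((\<lambda>y::real. poly p y * exp (- y)) \<longlongrightarrow> 0) at_top"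
proof -
  have "((\<lambda>y::real. \<Sum>i\<le>degree p. coeff p i * (y ^ i / exp y)) \<longlongrightarrow> (\<Sum>i\<le>degree p. coeff p i * 0)) at_top"
    by (intro tendsto_intros tendsto_power_div_exp_0)
  moreover have "(\<lambda>y::real. \<Sum>i\<le>degree p. coeff p i * (y ^ i / exp y)) = (\<lambda>y. poly p y * exp (- y))"
    by (simp add: poly_altdef sum_divide_distrib exp_minus field_simps)
  ultimately show ?thesis by simp
qed

text \<open>On the right the product rule gives \<open>y\<^sup>2 (p(y) - p'(y)) exp (- y)\<close> at \<open>y = 1 / x\<close>; at the origin the
  difference quotient is \<open>y p(y) exp (- y)\<close> with \<open>y\<close> tending to infinity.\<close>

lemma flat_fun_has_real_derivative:
  "(flat_fun p has_real_derivative flat_fun ([:0, 0, 1:] * (p - pderiv p)) x) (at x)"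
proof (cases x "0::real" rule: linorder_cases)
  case less
  have "((\<lambda>_. 0) has_real_derivative 0) (at x)" by simp
  hence "(flat_fun p has_real_derivative 0) (at x)"
    by (rule has_field_derivative_transform_within_open[of _ _ _ "{..<0}"]) (use less in \<open>auto simp: flat_fun_def\<close>)
  then show ?thesis using less by (simp add: flat_fun_def)
next
  case equal
  have "((\<lambda>h. flat_fun p h / h) \<longlongrightarrow> 0) (at_left 0)"
    by (rule tendsto_eventually) (auto simp: flat_fun_def eventually_at_filter)
  moreover have "((\<lambda>h. flat_fun p h / h) \<longlongrightarrow> 0) (at_right 0)"
    unfolding filterlim_at_right_to_top
  proof (rule Lim_transform_eventually[OF poly_times_exp_minus_tendsto_0[of "[:0, 1:] * p"]])
    show "\<forall>\<^sub>F y in at_top. poly ([:0, 1:] * p) y * exp (- y) = flat_fun p (inverse y) / inverse y"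
      using eventually_gt_at_top[of 0] by eventually_elim (auto simp: flat_fun_def field_simps)
  qed
  ultimately have "((\<lambda>h. flat_fun p h / h) \<longlongrightarrow> 0) (at 0)"
    by (rule filterlim_split_at)
  then show ?thesis using equal by (simp add: DERIV_def flat_fun_def)
next
  case greater
  have "((\<lambda>x. poly p (1 / x) * exp (- (1 / x))) has_real_derivative
      poly ([:0, 0, 1:] * (p - pderiv p)) (1 / x) * exp (- (1 / x))) (at x)"
    using greater by (auto intro!: derivative_eq_intros simp: field_simps power2_eq_square)
  hence "(flat_fun p has_real_derivative poly ([:0, 0, 1:] * (p - pderiv p)) (1 / x) * exp (- (1 / x))) (at x)"
    by (rule has_field_derivative_transform_within_open[of _ _ _ "{0<..}"]) (use greater in \<open>auto simp: flat_fun_def\<close>)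
  then show ?thesis using greater by (simp add: flat_fun_def)
qed

lemma Ck_on_flat_fun: "Ck_on k UNIV (flat_fun p)"
proof (induction k arbitrary: p)
  case 0
  then show ?case
    by (auto intro!: continuous_at_imp_continuous_on DERIV_isCont[OF flat_fun_has_real_derivative])
next
  case (Suc k)
  let ?q = "[:0, 0, 1:] * (p - pderiv p)"
  show ?case
  proof (rule Ck_on_SucI)
    show "(flat_fun p has_derivative (\<lambda>v. flat_fun ?q x * v)) (at x)" for x
      using flat_fun_has_real_derivative by (rule has_field_derivative_imp_has_derivative)
    show "Ck_on k UNIV (\<lambda>x. flat_fun ?q x * v)" for v
      using Ck_on_linear_compose[OF bounded_linear_mult_left open_UNIV Suc.IH] .
  qed simp
qed

lemma exists_bump_function:
  fixes a :: "'a::euclidean_space"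
  assumes "0 < r"
  obtains \<beta> :: "'a \<Rightarrow> real" where "smooth_on UNIV \<beta>" "\<beta> a = 1" "\<And>x. x \<notin> cball a r \<Longrightarrow> \<beta> x = 0"
proof -
  \<comment> \<open>\<open>s\<close> is positive exactly on the open ball, so the flat function of \<open>s\<close> vanishes outside of it\<close>
  define s where "s = (\<lambda>x. r\<^sup>2 + - ((x - a) \<bullet> (x - a)))"
  define \<beta> where "\<beta> = (\<lambda>x. inverse (flat_fun 1 (r\<^sup>2)) *\<^sub>R flat_fun 1 (s x))"
  have sk: "Ck_on k UNIV s" for k
  proof -
    have d: "Ck_on k UNIV (\<lambda>x. x - a)"
      using Ck_on_add[OF open_UNIV Ck_on_bounded_linear[OF bounded_linear_ident open_UNIV] Ck_on_const[of UNIV k "-a"]]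
      by simp
    show ?thesis unfolding s_def
      by (intro Ck_on_add Ck_on_const Ck_on_linear_compose[OF bounded_linear_minus[OF bounded_linear_ident]]
          Ck_on_bilinear[OF bounded_bilinear_inner] d open_UNIV)
  qed
  have "Ck_on k UNIV (flat_fun 1 \<circ> s)" for k
    by (rule Ck_on_compose[OF open_UNIV _ sk Ck_on_flat_fun]) simp
  hence "smooth_on UNIV (\<lambda>x. flat_fun 1 (s x))"
    by (simp add: smooth_on_def o_def)
  hence "smooth_on UNIV \<beta>"
    unfolding \<beta>_def by (intro smooth_on_scaleR smooth_on_const open_UNIV)
  moreover have "\<beta> a = 1" using assms by (simp add: \<beta>_def s_def flat_fun_def)
  moreover have "\<beta> x = 0" if "x \<notin> cball a r" for x
  proof -
    have "r \<le> norm (x - a)" using that by (simp add: dist_norm norm_minus_commute)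
    hence "r\<^sup>2 \<le> (norm (x - a))\<^sup>2" using assms by (intro power_mono) auto
    thus ?thesis by (simp add: \<beta>_def s_def flat_fun_def power2_norm_eq_inner)
  qed
  ultimately show ?thesis using that by blast
qed

section \<open>Charts, tangent vectors and vector fields\<close>

lemma transition_deriv_has_derivative':
  assumes "smooth_on (coord c ` (dom_of c \<inter> dom_of d)) (coord d \<circ> inv_coord c)" "p \<in> dom_of c" "p \<in> dom_of d"
  shows "(coord d \<circ> inv_coord c has_derivative transition_deriv c d p) (at (coord c p))"
  unfolding transition_deriv_def using assms by (intro smooth_on_has_derivative) auto

lemma tangent_space_trans:
  "v \<in> tangent_space M p \<Longrightarrow> c \<in> charts_at M p \<Longrightarrow> d \<in> charts_at M p \<Longrightarrow>
    v d = transition_deriv c d p (v c)"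
  unfolding tangent_space_def by blast

lemma tangent_space_outside: "v \<in> tangent_space M p \<Longrightarrow> c \<notin> charts_at M p \<Longrightarrow> v c = 0"
  unfolding tangent_space_def by blast

lemma tangent_spaceI:
  assumes "\<And>c d. c \<in> charts_at M p \<Longrightarrow> d \<in> charts_at M p \<Longrightarrow> v d = transition_deriv c d p (v c)"
    and "\<And>c. c \<notin> charts_at M p \<Longrightarrow> v c = 0"
  shows "v \<in> tangent_space M p"
  unfolding tangent_space_def using assms by blast

context
  fixes M :: "('p, 'e::euclidean_space, 'z) mfd_scheme"
  assumes M: "smooth_manifold M"
begin

lemma homeomorphic_chart:
  assumes "c \<in> atlas M"
  shows "homeomorphic_map (subtopology (mtop M) (dom_of c)) (top_of_set (coord c ` dom_of c)) (coord c)"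
  using M assms by (simp add: smooth_manifold_def)

lemma openin_dom: "c \<in> atlas M \<Longrightarrow> openin (mtop M) (dom_of c)"
  using M by (simp add: smooth_manifold_def)

lemma open_coord_dom: "c \<in> atlas M \<Longrightarrow> open (coord c ` dom_of c)"
  using M by (simp add: smooth_manifold_def)

lemma dom_subset_points: "c \<in> atlas M \<Longrightarrow> dom_of c \<subseteq> points M"
  using openin_dom openin_subset by blast

lemma inj_on_coord:
  assumes "c \<in> atlas M"
  shows "inj_on (coord c) (dom_of c)"
proof -
  have "topspace (subtopology (mtop M) (dom_of c)) = dom_of c"
    using dom_subset_points[OF assms] by auto
  thus ?thesis using homeomorphic_imp_injective_map[OF homeomorphic_chart[OF assms]] by simp
qed

lemma inv_coord_coord [simp]: "c \<in> atlas M \<Longrightarrow> p \<in> dom_of c \<Longrightarrow> inv_coord c (coord c p) = p"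
  using inj_on_coord by (simp add: inv_coord_def)

lemma open_coord_image:
  assumes "c \<in> atlas M" "openin (mtop M) U"
  shows "open (coord c ` (dom_of c \<inter> U))"
proof -
  have "openin (subtopology (mtop M) (dom_of c)) (dom_of c \<inter> U)"
    using assms(2) by (rule openin_subtopology_Int2)
  hence "openin (top_of_set (coord c ` dom_of c)) (coord c ` (dom_of c \<inter> U))"
    using homeomorphic_imp_open_map[OF homeomorphic_chart[OF assms(1)]] by (simp add: open_map_def)
  thus ?thesis using open_coord_dom[OF assms(1)] by (simp add: openin_open_eq)
qed

lemma continuous_map_inv_coord:
  assumes "c \<in> atlas M"
  shows "continuous_map (top_of_set (coord c ` dom_of c)) (mtop M) (inv_coord c)"
proof -
  obtain g where g: "homeomorphic_maps (subtopology (mtop M) (dom_of c)) (top_of_set (coord c ` dom_of c)) (coord c) g"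
    using homeomorphic_chart[OF assms] homeomorphic_map_maps by blast
  have "inv_coord c x = g x" if "x \<in> coord c ` dom_of c" for x
    using that g assms dom_subset_points[OF assms] by (auto simp: homeomorphic_maps_def)
  moreover have "continuous_map (top_of_set (coord c ` dom_of c)) (mtop M) g"
    using g by (simp add: homeomorphic_maps_def continuous_map_in_subtopology)
  ultimately show ?thesis by (auto intro: continuous_map_eq[of _ _ g])
qed

lemma charts_at_iff: "c \<in> charts_at M p \<longleftrightarrow> c \<in> atlas M \<and> p \<in> dom_of c"
  by (simp add: charts_at_def)

lemma some_chart_in: "p \<in> points M \<Longrightarrow> some_chart M p \<in> charts_at M p"
proof -
  assume "p \<in> points M"
  hence "p \<in> (\<Union>c\<in>atlas M. dom_of c)" using M by (simp add: smooth_manifold_def)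
  hence "\<exists>c. c \<in> charts_at M p" by (auto simp: charts_at_def)
  thus ?thesis unfolding some_chart_def by (rule someI_ex)
qed

lemma some_chart_atlas [simp]: "p \<in> points M \<Longrightarrow> some_chart M p \<in> atlas M"
  and some_chart_dom [simp]: "p \<in> points M \<Longrightarrow> p \<in> dom_of (some_chart M p)"
  using some_chart_in by (auto simp: charts_at_iff)

lemma smooth_transition:
  "c \<in> atlas M \<Longrightarrow> d \<in> atlas M \<Longrightarrow>
    smooth_on (coord c ` (dom_of c \<inter> dom_of d)) (coord d \<circ> inv_coord c)"
  using M by (simp add: smooth_manifold_def)

lemma transition_deriv_has_derivative:
  assumes "c \<in> charts_at M p" "d \<in> charts_at M p"
  shows "(coord d \<circ> inv_coord c has_derivative transition_deriv c d p) (at (coord c p))"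
  using assms by (intro transition_deriv_has_derivative' smooth_transition) (auto simp: charts_at_iff)

lemma linear_transition_deriv:
  "c \<in> charts_at M p \<Longrightarrow> d \<in> charts_at M p \<Longrightarrow> linear (transition_deriv c d p)"
  using transition_deriv_has_derivative has_derivative_linear by blast

lemma has_derivative_change_chart:
  assumes c: "c \<in> charts_at M p" and d: "d \<in> charts_at M p"
    and h: "(h \<circ> inv_coord d has_derivative h') (at (coord d p))"
  shows "(h \<circ> inv_coord c has_derivative h' \<circ> transition_deriv c d p) (at (coord c p))"
proof (rule has_derivative_transform_within_open)
  from c d have in_atlas: "c \<in> atlas M" "d \<in> atlas M" "p \<in> dom_of c" "p \<in> dom_of d"
    by (auto simp: charts_at_iff)
  show "(h \<circ> inv_coord d \<circ> (coord d \<circ> inv_coord c) has_derivative h' \<circ> transition_deriv c d p) (at (coord c p))"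
    by (rule diff_chain_at[OF transition_deriv_has_derivative[OF c d]]) (use h in_atlas in simp)
  show "open (coord c ` (dom_of c \<inter> dom_of d))"
    by (rule open_coord_image[OF in_atlas(1) openin_dom[OF in_atlas(2)]])
  show "coord c p \<in> coord c ` (dom_of c \<inter> dom_of d)" using in_atlas by auto
  show "(h \<circ> inv_coord d \<circ> (coord d \<circ> inv_coord c)) x = (h \<circ> inv_coord c) x"
    if "x \<in> coord c ` (dom_of c \<inter> dom_of d)" for x
    using that in_atlas by auto
qed

lemma transition_deriv_compose:
  assumes "c \<in> charts_at M p" "d \<in> charts_at M p" "e \<in> charts_at M p"
  shows "transition_deriv d e p (transition_deriv c d p u) = transition_deriv c e p u"
proof -
  have "(coord e \<circ> inv_coord c has_derivative transition_deriv d e p \<circ> transition_deriv c d p) (at (coord c p))"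
    by (intro has_derivative_change_chart transition_deriv_has_derivative assms)
  from has_derivative_unique[OF this transition_deriv_has_derivative[OF assms(1,3)]]
  show ?thesis by (simp add: fun_eq_iff)
qed

lemma transition_deriv_self:
  assumes "c \<in> charts_at M p"
  shows "transition_deriv c c p u = u"
proof -
  from assms have c: "c \<in> atlas M" "p \<in> dom_of c" by (auto simp: charts_at_iff)
  have "(coord c \<circ> inv_coord c has_derivative (\<lambda>u. u)) (at (coord c p))"
    by (rule has_derivative_transform_within_open[OF has_derivative_ident open_coord_dom[OF c(1)]])
       (use c in auto)
  from has_derivative_unique[OF this transition_deriv_has_derivative[OF assms assms]]
  show ?thesis by (simp add: fun_eq_iff)
qed

lemma tangent_of_in_tangent_space:
  assumes "c \<in> charts_at M p"
  shows "tangent_of M p c u \<in> tangent_space M p"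
  using assms by (intro tangent_spaceI) (simp_all add: tangent_of_def transition_deriv_compose)

lemma tangent_of_self: "c \<in> charts_at M p \<Longrightarrow> tangent_of M p c u c = u"
  by (simp add: tangent_of_def transition_deriv_self)

lemma tangent_space_eqI:
  assumes "v \<in> tangent_space M p" "w \<in> tangent_space M p" "c \<in> charts_at M p" "v c = w c"
  shows "v = w"
proof
  fix d
  show "v d = w d"
  proof (cases "d \<in> charts_at M p")
    case True
    show ?thesis
      unfolding tangent_space_trans[OF assms(1,3) True] tangent_space_trans[OF assms(2,3) True] assms(4) ..
  next
    case False
    then show ?thesis using tangent_space_outside assms(1,2) by metis
  qed
qed

lemma tangent_of_components:
  assumes "v \<in> tangent_space M p" "c \<in> charts_at M p"
  shows "tangent_of M p c (v c) = v"
  by (rule tangent_space_eqI[OF tangent_of_in_tangent_space[OF assms(2)] assms(1,2)])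
     (simp add: tangent_of_self assms(2))

lemma tangent_space_add:
  assumes "v \<in> tangent_space M p" "w \<in> tangent_space M p"
  shows "(\<lambda>c. v c + w c) \<in> tangent_space M p"
proof (rule tangent_spaceI)
  fix c d assume c: "c \<in> charts_at M p" and d: "d \<in> charts_at M p"
  show "v d + w d = transition_deriv c d p (v c + w c)"
    unfolding linear_add[OF linear_transition_deriv[OF c d]] tangent_space_trans[OF assms(1) c d] tangent_space_trans[OF assms(2) c d] ..
qed (simp add: tangent_space_outside[OF assms(1)] tangent_space_outside[OF assms(2)])

lemma tangent_space_scaleR:
  assumes "v \<in> tangent_space M p"
  shows "(\<lambda>c. a *\<^sub>R v c) \<in> tangent_space M p"
proof (rule tangent_spaceI)
  fix c d assume c: "c \<in> charts_at M p" and d: "d \<in> charts_at M p"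
  show "a *\<^sub>R v d = transition_deriv c d p (a *\<^sub>R v c)"
    unfolding linear_scale[OF linear_transition_deriv[OF c d]] tangent_space_trans[OF assms c d] ..
qed (simp add: tangent_space_outside[OF assms(1)])

text \<open>Metric compatibility and the anti-torqued condition speak of globally defined smooth vector fields.
  This lemma turns them into statements about single tangent vectors: a field that is constant in a
  chart, cut off by a bump function, is globally smooth because the support of the cut-off is compact
  and hence closed in the (Hausdorff) manifold.\<close>

lemma exists_vector_field_extending:
  assumes v: "v \<in> tangent_space M p" and p: "p \<in> points M"
  obtains X where "vector_field M X" "X p = v"
proof -
  define c where "c = some_chart M p"
  have c: "c \<in> charts_at M p" "c \<in> atlas M" "p \<in> dom_of c" using p by (auto simp: c_def some_chart_in)
  have "coord c p \<in> coord c ` dom_of c" using c by simp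
  then obtain r where r: "0 < r" "cball (coord c p) r \<subseteq> coord c ` dom_of c"
    using open_coord_dom[OF c(2)] open_contains_cball by metis
  obtain \<beta> :: "'e \<Rightarrow> real" where \<beta>: "smooth_on UNIV \<beta>" "\<beta> (coord c p) = 1"
      "\<And>x. x \<notin> cball (coord c p) r \<Longrightarrow> \<beta> x = 0"
    using exists_bump_function[OF r(1)] by metis
  define K where "K = inv_coord c ` cball (coord c p) r"
  have "compactin (top_of_set (coord c ` dom_of c)) (cball (coord c p) r)"
    using r(2) by (simp add: compactin_subtopology)
  hence "compactin (mtop M) K"
    unfolding K_def using continuous_map_inv_coord[OF c(2)] image_compactin by blast
  hence K: "closedin (mtop M) K"
    using M by (auto simp: smooth_manifold_def intro: compactin_imp_closedin)
  have outside: "\<beta> (coord c q) = 0" if "q \<in> dom_of c" "q \<notin> K" for q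
  proof (rule \<beta>(3))
    show "coord c q \<notin> cball (coord c p) r"
      using that c inv_coord_coord[of c q] unfolding K_def by (metis imageI)
  qed
  define X where "X = (\<lambda>q. if q \<in> dom_of c then (\<lambda>d. \<beta> (coord c q) *\<^sub>R tangent_of M q c (v c) d) else (\<lambda>d. 0))"
  have zero: "(\<lambda>d. 0) \<in> tangent_space M q" for q
    by (rule tangent_spaceI) (simp_all add: linear_0[OF linear_transition_deriv])
  have tangent: "X q \<in> tangent_space M q" for q
    using zero tangent_space_scaleR[OF tangent_of_in_tangent_space[of c q "v c"]] c
    by (auto simp: X_def charts_at_iff)
  have smooth: "smooth_on (coord e ` (dom_of e \<inter> {q \<in> points M. id q \<in> dom_of d})) ((\<lambda>q. X q d) \<circ> inv_coord e)"
    if d: "d \<in> atlas M" and e: "e \<in> atlas M" for d e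
  proof (rule smooth_on_local)
    fix x assume "x \<in> coord e ` (dom_of e \<inter> {q \<in> points M. id q \<in> dom_of d})"
    then obtain q where q: "q \<in> points M" "q \<in> dom_of d" "q \<in> dom_of e" "x = coord e q" by auto
    show "\<exists>U. open U \<and> x \<in> U \<and> smooth_on U ((\<lambda>q. X q d) \<circ> inv_coord e)"
    \<comment> \<open>inside the chart \<open>c\<close> the field has a smooth formula; outside, it vanishes off the closed set \<open>K\<close>\<close>
    proof (cases "q \<in> dom_of c")
      case True
      let ?U = "coord e ` (dom_of e \<inter> (dom_of d \<inter> dom_of c))"
      let ?t = "coord c \<circ> inv_coord e"
      let ?g = "\<lambda>x. \<beta> (?t x) *\<^sub>R frechet_derivative (coord d \<circ> inv_coord c) (at (?t x)) (v c)"
      have U: "open ?U" by (intro open_coord_image e openin_Int openin_dom d c(2))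
      have t: "smooth_on ?U ?t" by (rule smooth_on_subset[OF smooth_transition[OF e c(2)]]) auto
      have \<beta>t: "smooth_on ?U (\<lambda>x. \<beta> (?t x))"
        using smooth_on_compose[OF t \<beta>(1) U] by (simp add: o_def)
      have "smooth_on ?U ((\<lambda>y. frechet_derivative (coord d \<circ> inv_coord c) (at y) (v c)) \<circ> ?t)"
        by (rule smooth_on_compose[OF t smooth_on_frechet_derivative[OF smooth_transition[OF c(2) d]] U])
           (use e in auto)
      with \<beta>t have g: "smooth_on ?U ?g" by (intro smooth_on_scaleR[OF U]) (simp_all add: o_def)
      have "smooth_on ?U ((\<lambda>q. X q d) \<circ> inv_coord e)"
        by (rule smooth_on_cong[OF U g])
           (use c(2) d e in \<open>auto simp: X_def tangent_of_def transition_deriv_def charts_at_iff\<close>)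
      with U q True show ?thesis by blast
    next
      case False
      let ?U = "coord e ` (dom_of e \<inter> (points M - K))"
      have U: "open ?U" by (intro open_coord_image e openin_diff openin_topspace K)
      have "q \<notin> K" using False r(2) c(2) by (auto simp: K_def)
      hence x: "x \<in> ?U" using q by auto
      have "smooth_on ?U ((\<lambda>q. X q d) \<circ> inv_coord e)"
        by (rule smooth_on_cong[OF U smooth_on_const[OF U, of 0]]) (use e outside in \<open>auto simp: X_def\<close>)
      with U x show ?thesis by blast
    qed
  qed
  have "vector_field M X"
    unfolding vector_field_along_def smooth_fun_def using tangent smooth by simp
  moreover have "X p = v"
    using c \<beta>(2) tangent_of_components[OF v c(1)] by (simp add: X_def)
  ultimately show ?thesis using that by blast
qed

end

section \<open>Derivatives along maps\<close>

text \<open>The product rule for a linear map that depends on the point and is applied to a vector that depends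
  on the point. The maps need to be linear only near the point in question, as is the case for metric
  tensors, whose values outside their chart are arbitrary. Expansion in a basis reduces the rule to
  the one for scalar multiples.\<close>

lemma has_derivative_linear_family:
  fixes L :: "'a::real_normed_vector \<Rightarrow> 'b::euclidean_space \<Rightarrow> 'c::real_normed_vector"
  assumes U: "open U" "x\<^sub>0 \<in> U" and lin: "\<And>x. x \<in> U \<Longrightarrow> linear (L x)"
    and L: "\<And>b. (\<lambda>x. L x b) differentiable (at x\<^sub>0)"
    and f: "(f has_derivative f') (at x\<^sub>0)"
  shows "((\<lambda>x. L x (f x)) has_derivative
           (\<lambda>h. frechet_derivative (\<lambda>x. L x (f x\<^sub>0)) (at x\<^sub>0) h + L x\<^sub>0 (f' h))) (at x\<^sub>0)"
proof -
  let ?D = "\<lambda>b. frechet_derivative (\<lambda>x. L x b) (at x\<^sub>0)"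
  have D: "((\<lambda>x. L x b) has_derivative ?D b) (at x\<^sub>0)" for b
    using L frechet_derivative_works by blast
  have expand: "(\<Sum>b\<in>Basis. (a \<bullet> b) *\<^sub>R L x b) = L x a" if "x \<in> U" for x a
  proof -
    have "L x a = L x (\<Sum>b\<in>Basis. (a \<bullet> b) *\<^sub>R b)" by (simp add: euclidean_representation)
    thus ?thesis using lin[OF that] by (simp add: linear_sum linear_scale)
  qed
  \<comment> \<open>this will be used for \<open>f\<close> itself and for the constant map with value \<open>f x\<^sub>0\<close>, which identifies the sum\<close>
  have *: "((\<lambda>x. L x (g x)) has_derivative
       (\<lambda>h. (\<Sum>b\<in>Basis. (g x\<^sub>0 \<bullet> b) *\<^sub>R ?D b h) + L x\<^sub>0 (g' h))) (at x\<^sub>0)"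
    if g: "(g has_derivative g') (at x\<^sub>0)" for g g'
  proof (rule has_derivative_transform_within_open[OF _ U])
    have "((\<lambda>x. \<Sum>b\<in>Basis. (g x \<bullet> b) *\<^sub>R L x b) has_derivative
       (\<lambda>h. \<Sum>b\<in>Basis. (g x\<^sub>0 \<bullet> b) *\<^sub>R ?D b h + (g' h \<bullet> b) *\<^sub>R L x\<^sub>0 b)) (at x\<^sub>0)"
      by (intro has_derivative_sum has_derivative_scaleR D has_derivative_inner_left g)
    thus "((\<lambda>x. \<Sum>b\<in>Basis. (g x \<bullet> b) *\<^sub>R L x b) has_derivative
       (\<lambda>h. (\<Sum>b\<in>Basis. (g x\<^sub>0 \<bullet> b) *\<^sub>R ?D b h) + L x\<^sub>0 (g' h))) (at x\<^sub>0)"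
      by (simp add: sum.distrib expand U)
  qed (simp add: expand)
  have "((\<lambda>x. L x (f x\<^sub>0)) has_derivative
       (\<lambda>h. (\<Sum>b\<in>Basis. (f x\<^sub>0 \<bullet> b) *\<^sub>R ?D b h) + L x\<^sub>0 0)) (at x\<^sub>0)"
    by (rule *) simp
  hence "?D (f x\<^sub>0) = (\<lambda>h. \<Sum>b\<in>Basis. (f x\<^sub>0 \<bullet> b) *\<^sub>R ?D b h)"
    using frechet_derivative_at linear_0[OF lin[OF U(2)]] by fastforce
  with *[OF f] show ?thesis by simp
qed

text \<open>Obtained by applying the rule for linear families in each of the two arguments.\<close>

lemma has_derivative_bilinear_family:
  fixes G :: "'a::real_normed_vector \<Rightarrow> 'b::euclidean_space \<Rightarrow> 'b \<Rightarrow> 'c::real_normed_vector"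
  assumes U: "open U" "x\<^sub>0 \<in> U" and bil: "\<And>x. x \<in> U \<Longrightarrow> bilinear (G x)"
    and G: "\<And>a b. (\<lambda>x. G x a b) differentiable (at x\<^sub>0)"
    and f: "(f has_derivative f') (at x\<^sub>0)" and g: "(g has_derivative g') (at x\<^sub>0)"
  shows "((\<lambda>x. G x (f x) (g x)) has_derivative
           (\<lambda>h. frechet_derivative (\<lambda>x. G x (f x\<^sub>0) (g x\<^sub>0)) (at x\<^sub>0) h +
                G x\<^sub>0 (f' h) (g x\<^sub>0) + G x\<^sub>0 (f x\<^sub>0) (g' h))) (at x\<^sub>0)"
proof -
  have *: "((\<lambda>x. G x (f x) b) has_derivative
       (\<lambda>h. frechet_derivative (\<lambda>x. G x (f x\<^sub>0) b) (at x\<^sub>0) h + G x\<^sub>0 (f' h) b)) (at x\<^sub>0)" for b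
    by (rule has_derivative_linear_family[OF U, of "\<lambda>x a. G x a b"])
       (use bil G f in \<open>auto simp: bilinear_def\<close>)
  have "((\<lambda>x. G x (f x) (g x)) has_derivative
           (\<lambda>h. frechet_derivative (\<lambda>x. G x (f x) (g x\<^sub>0)) (at x\<^sub>0) h + G x\<^sub>0 (f x\<^sub>0) (g' h))) (at x\<^sub>0)"
    by (rule has_derivative_linear_family[OF U, of "\<lambda>x. G x (f x)"])
       (use bil g in \<open>auto simp: bilinear_def intro: differentiableI[OF *]\<close>)
  thus ?thesis by (simp add: frechet_derivative_at[OF *, symmetric])
qed

lemma dir_deriv_eq:
  "(h \<circ> inv_coord (some_chart S p) has_derivative h') (at (coord (some_chart S p) p)) \<Longrightarrow>
    dir_deriv S p v h = h' (v (some_chart S p))"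
  unfolding dir_deriv_def Let_def by (simp add: frechet_derivative_at[symmetric])

lemma dir_deriv_const: "dir_deriv S p v (\<lambda>_. a) = 0"
  by (subst dir_deriv_eq[of _ _ _ "\<lambda>_. 0"]) (simp_all add: o_def)

lemma openin_preimage_dom:
  assumes "smooth_map S M F" "smooth_manifold M" "c \<in> atlas M"
  shows "openin (mtop S) {q \<in> points S. F q \<in> dom_of c}"
  using assms openin_dom[OF assms(2,3)]
  by (auto simp: smooth_map_def intro: openin_continuous_map_preimage)

lemma smooth_map_in_points:
  assumes "smooth_map S M F" "p \<in> points S"
  shows "F p \<in> points M"
  using assms by (auto simp: smooth_map_def continuous_map_def)

context
  fixes S :: "('s, 'k::euclidean_space, 'z) mfd_scheme"
  assumes S: "smooth_manifold S"
begin

lemma smooth_fun_has_derivative: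
  assumes "smooth_fun S U h" "p \<in> U" "p \<in> points S"
  shows "(h \<circ> inv_coord (some_chart S p) has_derivative
      frechet_derivative (h \<circ> inv_coord (some_chart S p)) (at (coord (some_chart S p) p)))
      (at (coord (some_chart S p) p))"
proof (rule smooth_on_has_derivative)
  show "smooth_on (coord (some_chart S p) ` (dom_of (some_chart S p) \<inter> U)) (h \<circ> inv_coord (some_chart S p))"
    using assms some_chart_atlas[OF S] by (simp add: smooth_fun_def)
qed (use assms some_chart_dom[OF S] in auto)

text \<open>Identities between fields hold only on the open set where a chart is defined; derivatives at a
  point do not see the rest.\<close>

lemma has_derivative_coord_cong:
  assumes "openin (mtop S) U" "p \<in> U" "\<And>q. q \<in> U \<Longrightarrow> h q = k q"
    and "(h \<circ> inv_coord (some_chart S p) has_derivative h') (at (coord (some_chart S p) p))"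
  shows "(k \<circ> inv_coord (some_chart S p) has_derivative h') (at (coord (some_chart S p) p))"
proof -
  have p: "p \<in> points S" using assms openin_subset by blast
  let ?s = "some_chart S p"
  show ?thesis
  proof (rule has_derivative_transform_within_open[OF assms(4)])
    show "open (coord ?s ` (dom_of ?s \<inter> U))"
      by (rule open_coord_image[OF S some_chart_atlas[OF S p] assms(1)])
  qed (use assms(2,3) some_chart_dom[OF S p] inv_coord_coord[OF S some_chart_atlas[OF S p]] in auto)
qed

lemma dir_deriv_cong:
  assumes "openin (mtop S) U" "p \<in> U" "\<And>q. q \<in> U \<Longrightarrow> h q = k q"
  shows "dir_deriv S p v h = dir_deriv S p v k"
proof -
  have "(h \<circ> inv_coord (some_chart S p) has_derivative h') (at (coord (some_chart S p) p)) \<longleftrightarrow>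
    (k \<circ> inv_coord (some_chart S p) has_derivative h') (at (coord (some_chart S p) p))" for h'
    using has_derivative_coord_cong[OF assms(1,2), of h k h'] has_derivative_coord_cong[OF assms(1,2), of k h h'] assms(3)
    by metis
  thus ?thesis by (simp add: dir_deriv_def frechet_derivative_def Let_def)
qed

end

context
  fixes S :: "('s, 'k::euclidean_space, 'y) mfd_scheme"
    and M :: "('m, 'e::euclidean_space, 'z) mfd_scheme"
    and F :: "'s \<Rightarrow> 'm"
  assumes S: "smooth_manifold S" and M: "smooth_manifold M" and F: "smooth_map S M F"
begin

lemma smooth_map_coord_has_derivative:
  assumes "p \<in> points S" "c \<in> charts_at M (F p)"
  shows "(coord c \<circ> F \<circ> inv_coord (some_chart S p) has_derivative
      frechet_derivative (coord c \<circ> F \<circ> inv_coord (some_chart S p)) (at (coord (some_chart S p) p)))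
      (at (coord (some_chart S p) p))"
  by (rule smooth_fun_has_derivative[OF S, where U = "{p \<in> points S. F p \<in> dom_of c}"])
     (use F assms in \<open>auto simp: smooth_map_def charts_at_def\<close>)

lemma differential_eq:
  assumes "c \<in> charts_at M (F p)"
  shows "differential S M F p v c =
    frechet_derivative (coord c \<circ> F \<circ> inv_coord (some_chart S p)) (at (coord (some_chart S p) p)) (v (some_chart S p))"
  using assms by (simp add: differential_def dir_deriv_def Let_def)

lemma has_derivative_along:
  assumes p: "p \<in> points S" and c: "c \<in> charts_at M (F p)"
    and k: "(k \<circ> inv_coord c has_derivative k') (at (coord c (F p)))"
  shows "((k \<circ> F) \<circ> inv_coord (some_chart S p) has_derivative
      k' \<circ> frechet_derivative (coord c \<circ> F \<circ> inv_coord (some_chart S p)) (at (coord (some_chart S p) p)))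
      (at (coord (some_chart S p) p))"
proof (rule has_derivative_coord_cong[OF S])
  have c': "c \<in> atlas M" "F p \<in> dom_of c" using c by (auto simp: charts_at_def)
  show "openin (mtop S) {q \<in> points S. F q \<in> dom_of c}"
    by (rule openin_preimage_dom[OF F M c'(1)])
  show "p \<in> {q \<in> points S. F q \<in> dom_of c}" using p c' by simp
  show "((k \<circ> inv_coord c) \<circ> (coord c \<circ> F)) q = (k \<circ> F) q" if "q \<in> {q \<in> points S. F q \<in> dom_of c}" for q
    using that c' inv_coord_coord[OF M] by simp
  let ?s = "some_chart S p"
  have "(coord c \<circ> F \<circ> inv_coord ?s) (coord ?s p) = coord c (F p)"
    using p S by (simp add: inv_coord_coord[OF S])
  with k diff_chain_at[OF smooth_map_coord_has_derivative[OF p c], of "k \<circ> inv_coord c" k']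
  show "(k \<circ> inv_coord c \<circ> (coord c \<circ> F) \<circ> inv_coord ?s has_derivative
      k' \<circ> frechet_derivative (coord c \<circ> F \<circ> inv_coord ?s) (at (coord ?s p))) (at (coord ?s p))"
    by (simp add: o_assoc)
qed

lemma dir_deriv_along:
  assumes "p \<in> points S" "c \<in> charts_at M (F p)"
    and "(k \<circ> inv_coord c has_derivative k') (at (coord c (F p)))"
  shows "dir_deriv S p v (k \<circ> F) = k' (differential S M F p v c)"
  using dir_deriv_eq[OF has_derivative_along[OF assms]] differential_eq[OF assms(2)] by simp

lemma differential_in_tangent_space:
  assumes p: "p \<in> points S"
  shows "differential S M F p v \<in> tangent_space M (F p)"
proof (rule tangent_spaceI)
  fix c d assume c: "c \<in> charts_at M (F p)" and d: "d \<in> charts_at M (F p)"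
  have "dir_deriv S p v (coord d \<circ> F) = transition_deriv c d (F p) (differential S M F p v c)"
    by (rule dir_deriv_along[OF p c transition_deriv_has_derivative[OF M c d]])
  thus "differential S M F p v d = transition_deriv c d (F p) (differential S M F p v c)"
    using d by (simp add: differential_def)
qed (simp add: differential_def)

lemma differential_scaleR:
  assumes p: "p \<in> points S"
  shows "differential S M F p (\<lambda>c. a *\<^sub>R v c) = (\<lambda>c. a *\<^sub>R differential S M F p v c)"
proof
  fix c
  show "differential S M F p (\<lambda>c. a *\<^sub>R v c) c = a *\<^sub>R differential S M F p v c"
  proof (cases "c \<in> charts_at M (F p)")
    case True
    from has_derivative_linear[OF smooth_map_coord_has_derivative[OF p True]]
    show ?thesis by (simp add: differential_eq[OF True] linear_scale)
  qed (simp add: differential_def)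
qed

lemma vector_field_along_has_derivative:
  assumes p: "p \<in> points S" and V: "vector_field_along S M F V" and c: "c \<in> charts_at M (F p)"
  shows "((\<lambda>q. V q c) \<circ> inv_coord (some_chart S p) has_derivative
      frechet_derivative ((\<lambda>q. V q c) \<circ> inv_coord (some_chart S p)) (at (coord (some_chart S p) p)))
      (at (coord (some_chart S p) p))"
  by (rule smooth_fun_has_derivative[OF S, where U = "{p \<in> points S. F p \<in> dom_of c}"])
     (use V p c in \<open>auto simp: vector_field_along_def charts_at_def\<close>)

text \<open>Differentiating the components of \<open>V\<close> in a second chart produces a second derivative of the
  change of coordinates; the transformation law of the Christoffel symbols cancels it.\<close>

lemma cov_deriv_in_tangent_space:
  assumes conn: "connection M \<Gamma>" and V: "vector_field_along S M F V" and p: "p \<in> points S"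
  shows "cov_deriv S M \<Gamma> F p v V \<in> tangent_space M (F p)"
proof (rule tangent_spaceI)
  fix c d assume c: "c \<in> charts_at M (F p)" and d: "d \<in> charts_at M (F p)"
  have c': "c \<in> atlas M" "F p \<in> dom_of c" and d': "d \<in> atlas M" "F p \<in> dom_of d"
    using c d by (auto simp: charts_at_def)
  let ?s = "some_chart S p"
  let ?\<tau> = "coord d \<circ> inv_coord c"
  let ?D2 = "\<lambda>a. frechet_derivative (\<lambda>y. frechet_derivative ?\<tau> (at y) a) (at (coord c (F p)))"
  let ?u = "differential S M F p v c"
  define U where "U = {q \<in> points S. F q \<in> dom_of c} \<inter> {q \<in> points S. F q \<in> dom_of d}"
  have U: "openin (mtop S) U" "p \<in> U"
    unfolding U_def using openin_Int[OF openin_preimage_dom[OF F M c'(1)] openin_preimage_dom[OF F M d'(1)]] c' d' p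
    by simp_all
  have s: "?s \<in> atlas S" "p \<in> dom_of ?s" "inv_coord ?s (coord ?s p) = p"
    using p S by (auto simp: inv_coord_coord[OF S])
  have td: "transition_deriv c d (F p) = frechet_derivative ?\<tau> (at (coord c (F p)))"
    by (simp add: transition_deriv_def)
  define L where "L = (\<lambda>x. transition_deriv c d (F (inv_coord ?s x)))"
  have L: "((\<lambda>x. L x a) has_derivative
      ?D2 a \<circ> frechet_derivative (coord c \<circ> F \<circ> inv_coord ?s) (at (coord ?s p))) (at (coord ?s p))" for a
  proof -
    have "((\<lambda>y. frechet_derivative ?\<tau> (at y) a) has_derivative ?D2 a) (at (coord c (F p)))"
      by (rule smooth_on_has_derivative[OF smooth_on_frechet_derivative[OF smooth_transition[OF M c'(1) d'(1)]]])
         (use c' d' in auto)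
    hence "((\<lambda>q. transition_deriv c d q a) \<circ> inv_coord c has_derivative ?D2 a) (at (coord c (F p)))"
      by (rule has_derivative_transform_within_open[OF _ open_coord_dom[OF M c'(1)]])
         (use c' in \<open>auto simp: transition_deriv_def inv_coord_coord[OF M]\<close>)
    from has_derivative_along[OF p c this] show ?thesis by (simp add: o_def L_def)
  qed
  have V_d: "((\<lambda>x. L x (V (inv_coord ?s x) c)) has_derivative
      (\<lambda>h. frechet_derivative (\<lambda>x. L x (V (inv_coord ?s (coord ?s p)) c)) (at (coord ?s p)) h +
        L (coord ?s p) (frechet_derivative ((\<lambda>q. V q c) \<circ> inv_coord ?s) (at (coord ?s p)) h)))
      (at (coord ?s p))"
  proof (rule has_derivative_linear_family)
    show "open (coord ?s ` (dom_of ?s \<inter> U))" by (rule open_coord_image[OF S s(1) U(1)])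
    show "coord ?s p \<in> coord ?s ` (dom_of ?s \<inter> U)" using s U by auto
    show "linear (L x)" if "x \<in> coord ?s ` (dom_of ?s \<inter> U)" for x
      using that s(1) c'(1) d'(1)
      by (auto simp: L_def U_def inv_coord_coord[OF S] charts_at_def intro!: linear_transition_deriv[OF M])
    show "(\<lambda>x. L x b) differentiable (at (coord ?s p))" for b
      using L by (auto simp: differentiable_def)
    show "((\<lambda>x. V (inv_coord ?s x) c) has_derivative
        frechet_derivative ((\<lambda>q. V q c) \<circ> inv_coord ?s) (at (coord ?s p))) (at (coord ?s p))"
      using vector_field_along_has_derivative[OF p V c] by (simp add: o_def)
  qed
  have "dir_deriv S p v (\<lambda>q. V q d) = dir_deriv S p v (\<lambda>q. transition_deriv c d (F q) (V q c))"
  proof (rule dir_deriv_cong[OF S U])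
    fix q assume q: "q \<in> U"
    show "V q d = transition_deriv c d (F q) (V q c)"
      by (rule tangent_space_trans) (use q V c' d' in \<open>auto simp: U_def vector_field_along_def charts_at_def\<close>)
  qed
  also have "\<dots> = ?D2 (V p c) ?u + transition_deriv c d (F p) (dir_deriv S p v (\<lambda>q. V q c))"
  proof -
    have "dir_deriv S p v (\<lambda>q. V q c) =
        frechet_derivative ((\<lambda>q. V q c) \<circ> inv_coord ?s) (at (coord ?s p)) (v ?s)"
      by (rule dir_deriv_eq[OF vector_field_along_has_derivative[OF p V c]])
    moreover have "dir_deriv S p v (\<lambda>q. transition_deriv c d (F q) (V q c)) =
        frechet_derivative (\<lambda>x. L x (V p c)) (at (coord ?s p)) (v ?s) +
        L (coord ?s p) (frechet_derivative ((\<lambda>q. V q c) \<circ> inv_coord ?s) (at (coord ?s p)) (v ?s))"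
      by (rule dir_deriv_eq[where h' = "\<lambda>h. frechet_derivative (\<lambda>x. L x (V p c)) (at (coord ?s p)) h + _ h"])
         (use V_d s(3) in \<open>simp add: o_def L_def\<close>)
    moreover have "frechet_derivative (\<lambda>x. L x (V p c)) (at (coord ?s p)) (v ?s) = ?D2 (V p c) ?u"
      unfolding frechet_derivative_at[OF L, symmetric] differential_eq[OF c] by simp
    moreover have "L (coord ?s p) = transition_deriv c d (F p)" by (simp add: L_def s(3))
    ultimately show ?thesis by simp
  qed
  finally have V': "dir_deriv S p v (\<lambda>q. V q d) =
      ?D2 (V p c) ?u + transition_deriv c d (F p) (dir_deriv S p v (\<lambda>q. V q c))" .
  have Vd: "V p d = transition_deriv c d (F p) (V p c)"
    by (rule tangent_space_trans[OF _ c d]) (use V p in \<open>auto simp: vector_field_along_def\<close>)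
  have ud: "differential S M F p v d = transition_deriv c d (F p) ?u"
    by (rule tangent_space_trans[OF differential_in_tangent_space[OF p] c d])
  have \<Gamma>: "\<Gamma> d (F p) (differential S M F p v d) (V p d) =
      transition_deriv c d (F p) (\<Gamma> c (F p) ?u (V p c)) - ?D2 (V p c) ?u"
    unfolding Vd ud using conn c' d' unfolding connection_def by blast
  have "cov_deriv S M \<Gamma> F p v V d = dir_deriv S p v (\<lambda>q. V q d) + \<Gamma> d (F p) (differential S M F p v d) (V p d)"
    using d by (simp add: cov_deriv_def)
  also have "\<dots> = transition_deriv c d (F p) (dir_deriv S p v (\<lambda>q. V q c)) +
      transition_deriv c d (F p) (\<Gamma> c (F p) ?u (V p c))"
    unfolding V' \<Gamma> by simp
  also have "\<dots> = transition_deriv c d (F p) (cov_deriv S M \<Gamma> F p v V c)"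
    using c by (simp add: cov_deriv_def linear_add[OF linear_transition_deriv[OF M c d]])
  finally show "cov_deriv S M \<Gamma> F p v V d = transition_deriv c d (F p) (cov_deriv S M \<Gamma> F p v V c)" .
qed (simp add: cov_deriv_def)

end

section \<open>The metric and the Levi-Civita connection along a map\<close>

lemma vector_field_along_in_tangent_space:
  "vector_field_along S M F V \<Longrightarrow> p \<in> points S \<Longrightarrow> V p \<in> tangent_space M (F p)"
  by (simp add: vector_field_along_def)

lemma smooth_map_id:
  assumes "smooth_manifold M"
  shows "smooth_map M M id"
  unfolding smooth_map_def smooth_fun_def
proof (intro conjI ballI)
  fix c e assume c: "c \<in> atlas M" and e: "e \<in> atlas M"
  show "smooth_on (coord e ` (dom_of e \<inter> {p \<in> points M. id p \<in> dom_of c})) (coord c \<circ> id \<circ> inv_coord e)"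
    by (rule smooth_on_subset[of "coord e ` (dom_of e \<inter> dom_of c)"])
       (use smooth_transition[OF assms e c] in auto)
qed simp

lemma differential_id:
  assumes M: "smooth_manifold M" and p: "p \<in> points M" and v: "v \<in> tangent_space M p"
  shows "differential M M id p v = v"
proof
  fix c
  show "differential M M id p v c = v c"
  proof (cases "c \<in> charts_at M p")
    case True
    have "dir_deriv M p v (coord c \<circ> id) = transition_deriv (some_chart M p) c p (v (some_chart M p))"
      by (rule dir_deriv_eq)
         (simp add: transition_deriv_has_derivative[OF M some_chart_in[OF M p] True])
    also have "\<dots> = v c" using tangent_space_trans[OF v some_chart_in[OF M p] True] by simp
    finally show ?thesis using True by (simp add: differential_def)
  next
    case False
    then show ?thesis using tangent_space_outside[OF v] by (simp add: differential_def)
  qed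
qed

context
  fixes M :: "('m, 'e::euclidean_space) riem_mfd"
  assumes R: "riemannian_manifold M"
begin

lemma riemannian_smooth_manifold: "smooth_manifold M"
  using R by (simp add: riemannian_manifold_def)

lemma gcomp_bilinear: "c \<in> charts_at M p \<Longrightarrow> bilinear (gcomp M c p)"
  and gcomp_commute: "c \<in> charts_at M p \<Longrightarrow> gcomp M c p u v = gcomp M c p v u"
  and gcomp_pos: "c \<in> charts_at M p \<Longrightarrow> u \<noteq> 0 \<Longrightarrow> gcomp M c p u u > 0"
  using R unfolding riemannian_manifold_def charts_at_def by blast+

lemma gcomp_smooth: "c \<in> atlas M \<Longrightarrow> smooth_fun M (dom_of c) (\<lambda>p. gcomp M c p u v)"
  using R unfolding riemannian_manifold_def by blast

lemma ip_chart:
  assumes "c \<in> charts_at M p" "v \<in> tangent_space M p" "w \<in> tangent_space M p"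
  shows "ip M p v w = gcomp M c p (v c) (w c)"
proof -
  let ?s = "some_chart M p"
  have "p \<in> points M"
    using assms(1) dom_subset_points[OF riemannian_smooth_manifold, of c] by (auto simp: charts_at_def)
  hence s: "?s \<in> charts_at M p" by (rule some_chart_in[OF riemannian_smooth_manifold])
  have "gcomp M c p (transition_deriv ?s c p (v ?s)) (transition_deriv ?s c p (w ?s)) = gcomp M ?s p (v ?s) (w ?s)"
    using R s assms(1) unfolding riemannian_manifold_def charts_at_def by blast
  thus ?thesis
    using tangent_space_trans[OF assms(2) s assms(1)] tangent_space_trans[OF assms(3) s assms(1)]
    by (simp add: ip_def Let_def)
qed

context
  fixes p assumes p: "p \<in> points M"
begin

lemma some_chart_bilinear: "bilinear (gcomp M (some_chart M p) p)"
  by (intro gcomp_bilinear some_chart_in riemannian_smooth_manifold p)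

lemma ip_commute: "ip M p v w = ip M p w v"
  unfolding ip_def Let_def by (intro gcomp_commute some_chart_in riemannian_smooth_manifold p)

lemma ip_scaleR_left: "ip M p (\<lambda>c. a *\<^sub>R v c) w = a * ip M p v w"
  using bilinear_lmul[OF some_chart_bilinear] by (simp add: ip_def Let_def)

lemma ip_diff_left: "ip M p (\<lambda>c. v c - u c) w = ip M p v w - ip M p u w"
  using bilinear_lsub[OF some_chart_bilinear] by (simp add: ip_def Let_def)

lemma ip_minus_left: "ip M p (\<lambda>c. - v c) w = - ip M p v w"
  using bilinear_lneg[OF some_chart_bilinear] by (simp add: ip_def Let_def)

lemma ip_self_eq_0:
  assumes "v \<in> tangent_space M p" "ip M p v v = 0"
  shows "v = (\<lambda>c. 0)"
proof (rule tangent_space_eqI[OF riemannian_smooth_manifold assms(1)])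
  let ?s = "some_chart M p"
  show s: "?s \<in> charts_at M p" by (rule some_chart_in[OF riemannian_smooth_manifold p])
  show "v ?s = 0" using gcomp_pos[OF s, of "v ?s"] assms(2) by (auto simp: ip_def Let_def)
  show "(\<lambda>c. 0) \<in> tangent_space M p"
    using tangent_space_scaleR[OF riemannian_smooth_manifold assms(1), of 0] by simp
qed

text \<open>The case of equality in the Cauchy--Schwarz inequality: \<open>\<langle>v - w, v - w\<rangle> = 1 - 2 + 1 = 0\<close>.\<close>

lemma unit_vectors_eqI:
  assumes "v \<in> tangent_space M p" "w \<in> tangent_space M p"
    and "ip M p v v = 1" "ip M p w w = 1" "ip M p v w = 1"
  shows "v = w"
proof -
  let ?d = "\<lambda>c. v c - w c"
  have "?d \<in> tangent_space M p"
    using tangent_space_add[OF riemannian_smooth_manifold assms(1)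
        tangent_space_scaleR[OF riemannian_smooth_manifold assms(2), of "-1"]] by simp
  moreover have "ip M p ?d ?d = 0"
    using assms(3-5) by (simp add: ip_diff_left ip_commute[of _ ?d] ip_commute[of w v])
  ultimately have "?d = (\<lambda>c. 0)" by (rule ip_self_eq_0)
  thus ?thesis by (simp add: fun_eq_iff)
qed

end

text \<open>The inner product is defined with an unspecified chart at each point, which may vary with the point.
  Invariance of the metric permits one fixed chart \<open>c\<close> near \<open>F p\<close>, and the product rule for a
  bilinear form that depends on the point then separates the derivative of the metric tensor from
  those of the two fields.\<close>

lemma metric_component_derivative_along:
  fixes S :: "('s, 'k::euclidean_space, 'z) mfd_scheme"
  assumes S: "smooth_manifold S" and F: "smooth_map S M F"
    and V: "vector_field_along S M F V" and W: "vector_field_along S M F W"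
    and p: "p \<in> points S" and c: "c \<in> charts_at M (F p)"
  shows "dir_deriv S p v (\<lambda>q. ip M (F q) (V q) (W q)) =
    frechet_derivative (\<lambda>y. gcomp M c (inv_coord c y) (V p c) (W p c)) (at (coord c (F p))) (differential S M F p v c) +
    gcomp M c (F p) (dir_deriv S p v (\<lambda>q. V q c)) (W p c) +
    gcomp M c (F p) (V p c) (dir_deriv S p v (\<lambda>q. W q c))"
proof -
  note M = riemannian_smooth_manifold
  have c': "c \<in> atlas M" "F p \<in> dom_of c" using c by (auto simp: charts_at_def)
  let ?s = "some_chart S p"
  let ?x = "coord ?s p"
  let ?V = "(\<lambda>q. V q c) \<circ> inv_coord ?s" and ?W = "(\<lambda>q. W q c) \<circ> inv_coord ?s"
  let ?Dg = "\<lambda>a b. frechet_derivative (\<lambda>y. gcomp M c (inv_coord c y) a b) (at (coord c (F p)))"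
  have s: "?s \<in> atlas S" "p \<in> dom_of ?s" "inv_coord ?s ?x = p"
    using p S by (auto simp: inv_coord_coord[OF S])
  define U where "U = {q \<in> points S. F q \<in> dom_of c}"
  have U: "openin (mtop S) U" "p \<in> U"
    unfolding U_def using openin_preimage_dom[OF F M c'(1)] c' p by auto
  define G where "G = (\<lambda>x. gcomp M c (F (inv_coord ?s x)))"
  have G: "((\<lambda>x. G x a b) has_derivative ?Dg a b \<circ> frechet_derivative (coord c \<circ> F \<circ> inv_coord ?s) (at ?x)) (at ?x)" for a b
  proof -
    have "((\<lambda>q. gcomp M c q a b) \<circ> inv_coord c has_derivative
        frechet_derivative ((\<lambda>q. gcomp M c q a b) \<circ> inv_coord c) (at (coord c (F p)))) (at (coord c (F p)))"
      by (rule smooth_on_has_derivative[of "coord c ` (dom_of c \<inter> dom_of c)"])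
         (use gcomp_smooth[OF c'(1), unfolded smooth_fun_def, rule_format, OF c'(1)] c' in simp_all)
    from has_derivative_along[OF S M F p c this] show ?thesis by (simp add: o_def G_def)
  qed
  have prod: "((\<lambda>x. G x (?V x) (?W x)) has_derivative
      (\<lambda>h. frechet_derivative (\<lambda>x. G x (?V ?x) (?W ?x)) (at ?x) h +
        G ?x (frechet_derivative ?V (at ?x) h) (?W ?x) + G ?x (?V ?x) (frechet_derivative ?W (at ?x) h))) (at ?x)"
  proof (rule has_derivative_bilinear_family)
    show "open (coord ?s ` (dom_of ?s \<inter> U))" by (rule open_coord_image[OF S s(1) U(1)])
    show "?x \<in> coord ?s ` (dom_of ?s \<inter> U)" using s U by auto
    show "bilinear (G x)" if "x \<in> coord ?s ` (dom_of ?s \<inter> U)" for x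
      using that s(1) c'(1)
      by (auto simp: G_def U_def inv_coord_coord[OF S] charts_at_def intro!: gcomp_bilinear)
    show "(\<lambda>x. G x a b) differentiable (at ?x)" for a b
      by (rule differentiableI[OF G])
  qed (rule vector_field_along_has_derivative[OF S M F p V c] vector_field_along_has_derivative[OF S M F p W c])+
  have "dir_deriv S p v (\<lambda>q. ip M (F q) (V q) (W q)) = dir_deriv S p v (\<lambda>q. gcomp M c (F q) (V q c) (W q c))"
  proof (rule dir_deriv_cong[OF S U])
    fix q assume q: "q \<in> U"
    show "ip M (F q) (V q) (W q) = gcomp M c (F q) (V q c) (W q c)"
      by (rule ip_chart) (use q V W c' in \<open>auto simp: U_def vector_field_along_def charts_at_def\<close>)
  qed
  also have "\<dots> = frechet_derivative (\<lambda>x. G x (?V ?x) (?W ?x)) (at ?x) (v ?s) +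
        G ?x (frechet_derivative ?V (at ?x) (v ?s)) (?W ?x) + G ?x (?V ?x) (frechet_derivative ?W (at ?x) (v ?s))"
    by (rule dir_deriv_eq[where h' = "\<lambda>h. _ h + _ h + _ h"]) (use prod in \<open>simp add: o_def G_def\<close>)
  also have "frechet_derivative (\<lambda>x. G x (?V ?x) (?W ?x)) (at ?x) (v ?s) =
      ?Dg (V p c) (W p c) (differential S M F p v c)"
    unfolding frechet_derivative_at[OF G, symmetric] differential_eq[OF S M F c] by (simp add: s(3))
  also have "frechet_derivative ?V (at ?x) (v ?s) = dir_deriv S p v (\<lambda>q. V q c)"
    by (rule dir_deriv_eq[OF vector_field_along_has_derivative[OF S M F p V c], symmetric])
  also have "frechet_derivative ?W (at ?x) (v ?s) = dir_deriv S p v (\<lambda>q. W q c)"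
    by (rule dir_deriv_eq[OF vector_field_along_has_derivative[OF S M F p W c], symmetric])
  finally show ?thesis by (simp add: G_def s(3))
qed

context
  fixes \<Gamma> :: "('m, 'e) christoffel"
  assumes conn: "connection M \<Gamma>" and metric: "metric_compatible M \<Gamma>"
begin

text \<open>Metric compatibility is applied to global vector fields with prescribed values at the point. The derivatives of their components occur on both sides and drop out, which
  leaves Ricci's identity \<open>\<partial>\<^sub>u g(v, w) = g(\<Gamma>(u, v), w) + g(v, \<Gamma>(u, w))\<close>.\<close>

lemma ricci_identity:
  assumes p: "p \<in> points M"
  defines "c \<equiv> some_chart M p"
  shows "frechet_derivative (\<lambda>y. gcomp M c (inv_coord c y) v w) (at (coord c p)) u =
    gcomp M c p (\<Gamma> c p u v) w + gcomp M c p v (\<Gamma> c p u w)"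
proof -
  note M = riemannian_smooth_manifold
  have c: "c \<in> charts_at M p" unfolding c_def by (rule some_chart_in[OF M p])
  note bil = gcomp_bilinear[OF c]
  have field: "\<exists>X. vector_field M X \<and> X p = tangent_of M p c a" for a
    using exists_vector_field_extending[OF M tangent_of_in_tangent_space[OF M c, of a] p] by metis
  obtain X where X: "vector_field M X" "X p = tangent_of M p c u" using field by blast
  obtain Y where Y: "vector_field M Y" "Y p = tangent_of M p c v" using field by blast
  obtain Z where Z: "vector_field M Z" "Z p = tangent_of M p c w" using field by blast
  note comp = X(2)[THEN fun_cong, of c] Y(2)[THEN fun_cong, of c] Z(2)[THEN fun_cong, of c]
  note comp = comp[unfolded tangent_of_self[OF M c]]
  have id: "differential M M id p (X p) = X p"
    by (rule differential_id[OF M p]) (use X(1) p in \<open>auto simp: vector_field_along_def\<close>)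
  have cov: "cov_deriv M M \<Gamma> id p (X p) Y' c = dir_deriv M p (X p) (\<lambda>q. Y' q c) + \<Gamma> c p u (Y' p c)" for Y'
    using c by (simp add: cov_deriv_def id comp)
  have "dir_deriv M p (X p) (\<lambda>q. ip M q (Y q) (Z q)) =
      frechet_derivative (\<lambda>y. gcomp M c (inv_coord c y) v w) (at (coord c p)) u +
      gcomp M c p (dir_deriv M p (X p) (\<lambda>q. Y q c)) w + gcomp M c p v (dir_deriv M p (X p) (\<lambda>q. Z q c))"
    using metric_component_derivative_along[OF M smooth_map_id[OF M] Y(1) Z(1) p, of c "X p"] c
    by (simp add: id comp)
  moreover have "dir_deriv M p (X p) (\<lambda>q. ip M q (Y q) (Z q)) =
      ip M p (cov_deriv M M \<Gamma> id p (X p) Y) (Z p) + ip M p (Y p) (cov_deriv M M \<Gamma> id p (X p) Z)"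
    using metric X(1) Y(1) Z(1) p unfolding metric_compatible_def by blast
  moreover have "\<dots> = gcomp M c p (dir_deriv M p (X p) (\<lambda>q. Y q c) + \<Gamma> c p u v) w +
      gcomp M c p v (dir_deriv M p (X p) (\<lambda>q. Z q c) + \<Gamma> c p u w)"
    by (simp add: ip_def Let_def c_def[symmetric] cov comp)
  ultimately show ?thesis by (simp add: bilinear_ladd[OF bil] bilinear_radd[OF bil])
qed

text \<open>The fields along \<open>F\<close> need not extend to vector fields on \<open>M\<close>, so metric compatibility cannot be
  applied to them. Ricci's identity concerns the metric tensor alone, and together with the chain rule
  it gives the product rule for fields along any smooth map.\<close>

theorem metric_compatible_along:
  fixes S :: "('s, 'k::euclidean_space, 'z) mfd_scheme"
  assumes S: "smooth_manifold S" and F: "smooth_map S M F"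
    and V: "vector_field_along S M F V" and W: "vector_field_along S M F W"
    and p: "p \<in> points S"
  shows "dir_deriv S p v (\<lambda>q. ip M (F q) (V q) (W q)) =
    ip M (F p) (cov_deriv S M \<Gamma> F p v V) (W p) + ip M (F p) (V p) (cov_deriv S M \<Gamma> F p v W)"
proof -
  note M = riemannian_smooth_manifold
  have Fp: "F p \<in> points M" by (rule smooth_map_in_points[OF F p])
  define c where "c = some_chart M (F p)"
  have c: "c \<in> charts_at M (F p)" unfolding c_def by (rule some_chart_in[OF M Fp])
  note bil = gcomp_bilinear[OF c]
  show ?thesis
    unfolding metric_component_derivative_along[OF S F V W p c]
    using ricci_identity[OF Fp] c
    by (simp add: ip_def Let_def c_def[symmetric] cov_deriv_def bilinear_ladd[OF bil] bilinear_radd[OF bil])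
qed

end
end

section \<open>Hypersurfaces\<close>

lemma smooth_fun_uminus:
  assumes "smooth_manifold S" "smooth_fun S (points S) f"
  shows "smooth_fun S (points S) (\<lambda>p. - f p)"
  unfolding smooth_fun_def smooth_on_def
proof (intro ballI allI)
  fix c k assume c: "c \<in> atlas S"
  have "Ck_on k (coord c ` (dom_of c \<inter> points S)) (\<lambda>x. - (f \<circ> inv_coord c) x)"
    by (rule Ck_on_linear_compose[OF bounded_linear_minus[OF bounded_linear_ident]])
       (use assms c open_coord_image[OF assms(1) c openin_topspace] in
         \<open>simp_all add: smooth_fun_def smooth_on_def o_def\<close>)
  thus "Ck_on k (coord c ` (dom_of c \<inter> points S)) ((\<lambda>p. - f p) \<circ> inv_coord c)"
    by (simp add: o_def)
qed

lemma cov_deriv_cong: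
  assumes S: "smooth_manifold S" and p: "p \<in> points S" and eq: "\<And>q. q \<in> points S \<Longrightarrow> V q = W q"
  shows "cov_deriv S M \<Gamma> F p v V = cov_deriv S M \<Gamma> F p v W"
proof -
  have "dir_deriv S p v (\<lambda>q. V q c) = dir_deriv S p v (\<lambda>q. W q c)" for c
    by (rule dir_deriv_cong[OF S openin_topspace p]) (simp add: eq)
  thus ?thesis using eq[OF p] by (simp add: cov_deriv_def fun_eq_iff)
qed

text \<open>Both sides depend only on the value of the vector field at \<open>p\<close>, and every tangent vector is such a
  value.\<close>

lemma anti_torqued_pointwise:
  assumes S: "smooth_manifold S" and "anti_torqued S M \<Gamma> F V"
  shows "\<exists>f. smooth_fun S (points S) f \<and> (\<forall>p\<in>points S. \<forall>v\<in>tangent_space S p.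
    cov_deriv S M \<Gamma> F p v V =
      (\<lambda>c. f p *\<^sub>R (differential S M F p v c - ip M (F p) (differential S M F p v) (V p) *\<^sub>R V p c)))"
proof -
  obtain f where f: "smooth_fun S (points S) f"
    and eq: "\<And>X p. vector_field S X \<Longrightarrow> p \<in> points S \<Longrightarrow> cov_deriv S M \<Gamma> F p (X p) V =
      (\<lambda>c. f p *\<^sub>R (differential S M F p (X p) c - ip M (F p) (differential S M F p (X p)) (V p) *\<^sub>R V p c))"
    using assms(2) unfolding anti_torqued_def Let_def by blast
  have "cov_deriv S M \<Gamma> F p v V =
      (\<lambda>c. f p *\<^sub>R (differential S M F p v c - ip M (F p) (differential S M F p v) (V p) *\<^sub>R V p c))" if p: "p \<in> points S" and v: "v \<in> tangent_space S p" for p v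
  proof -
    obtain X where X: "vector_field S X" "X p = v" using exists_vector_field_extending[OF S v p] by blast
    show ?thesis using eq[OF X(1) p] unfolding X(2) .
  qed
  with f show ?thesis by blast
qed

lemma hypersurface_smooth_manifold: "hypersurface S M F \<Longrightarrow> smooth_manifold S"
  and hypersurface_smooth_map: "hypersurface S M F \<Longrightarrow> smooth_map S M F"
  and hypersurface_points: "hypersurface S M F \<Longrightarrow> p \<in> points S \<Longrightarrow> F p \<in> points M"
  by (auto simp: hypersurface_def intro: smooth_map_in_points)

context
  fixes M :: "('m, 'e::euclidean_space) riem_mfd" and S :: "('s, 'k::euclidean_space) mfd"
    and F :: "'s \<Rightarrow> 'm" and N :: "'s \<Rightarrow> ('m, 'e) tangent"
  assumes R: "riemannian_manifold M" and hyp: "hypersurface S M F" and N: "unit_normal S M F N"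
begin

private lemmas mfds = hypersurface_smooth_manifold[OF hyp] riemannian_smooth_manifold[OF R] hypersurface_smooth_map[OF hyp]

lemma unit_normal_vector_field: "vector_field_along S M F N"
  and unit_normal_unit: "p \<in> points S \<Longrightarrow> ip M (F p) (N p) (N p) = 1"
  and unit_normal_orthogonal: "p \<in> points S \<Longrightarrow> v \<in> tangent_space S p \<Longrightarrow> ip M (F p) (N p) (differential S M F p v) = 0"
  using N by (simp_all add: unit_normal_def unit_field_along_def)

lemma ip_unit_normal: "p \<in> points S \<Longrightarrow> v \<in> tangent_space S p \<Longrightarrow> ip M (F p) (differential S M F p v) (N p) = 0"
  using unit_normal_orthogonal ip_commute[OF R hypersurface_points[OF hyp]] by metis

lemma differential_inj:
  assumes "p \<in> points S" "v \<in> tangent_space S p" "w \<in> tangent_space S p"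
    and "differential S M F p v = differential S M F p w"
  shows "v = w"
  using hyp assms by (auto simp: hypersurface_def inj_on_def)

text \<open>The image of the differential lies in the orthogonal complement of the normal, and both have
  dimension one less than the ambient space.\<close>

lemma orthogonal_to_normal_is_tangential:
  assumes p: "p \<in> points S" and w: "w \<in> tangent_space M (F p)" and orth: "ip M (F p) w (N p) = 0"
  obtains u where "u \<in> tangent_space S p" "differential S M F p u = w"
proof -
  note Fp = hypersurface_points[OF hyp p]
  define c where "c = some_chart M (F p)"
  define s where "s = some_chart S p"
  have c: "c \<in> charts_at M (F p)" unfolding c_def by (rule some_chart_in[OF mfds(2) Fp])
  have s: "s \<in> charts_at S p" unfolding s_def by (rule some_chart_in[OF mfds(1) p])
  let ?n = "N p c"
  define L where "L = frechet_derivative (coord c \<circ> F \<circ> inv_coord s) (at (coord s p))"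
  have linL: "linear L"
    using has_derivative_linear[OF smooth_map_coord_has_derivative[OF mfds p c]] by (simp add: L_def s_def)
  have diff: "differential S M F p v c = L (v s)" for v
    using differential_eq[OF mfds c] by (simp add: L_def s_def)
  have tang: "tangent_of S p s u \<in> tangent_space S p" "tangent_of S p s u s = u" for u
    by (simp_all add: tangent_of_in_tangent_space[OF mfds(1) s] tangent_of_self[OF mfds(1) s])
  have "inj L"
  proof (rule injI)
    fix a b assume "L a = L b"
    have "differential S M F p (tangent_of S p s a) = differential S M F p (tangent_of S p s b)"
      by (rule tangent_space_eqI[OF mfds(2) differential_in_tangent_space[OF mfds p]
            differential_in_tangent_space[OF mfds p] c])
         (simp add: diff tang \<open>L a = L b\<close>)
    hence "tangent_of S p s a = tangent_of S p s b"
      using differential_inj[OF p tang(1) tang(1)] by blast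
    thus "a = b" using tang(2) by metis
  qed
  define H where "H = {x. gcomp M c (F p) x ?n = 0}"
  have bil: "linear (\<lambda>x. gcomp M c (F p) x ?n)"
    using gcomp_bilinear[OF R c] by (simp add: bilinear_def)
  have H: "subspace H"
    unfolding H_def subspace_def using linear_0[OF bil] linear_add[OF bil] linear_scale[OF bil] by simp
  have "?n \<notin> H" using unit_normal_unit[OF p] by (simp add: H_def ip_def Let_def c_def)
  hence "span H \<noteq> UNIV" using H by (metis UNIV_I span_eq_iff)
  hence "dim H < DIM('e)" using dim_eq_full[of H] dim_subset_UNIV[of H] by linarith
  moreover have "dim (range L) = DIM('k)"
    using dim_image_eq[OF linL, of UNIV] \<open>inj L\<close> by (simp add: dim_UNIV)
  ultimately have "dim H \<le> dim (range L)" using hyp by (simp add: hypersurface_def)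
  moreover have "range L \<subseteq> H"
  proof
    fix x assume "x \<in> range L"
    then obtain u where "x = L u" by blast
    thus "x \<in> H"
      using ip_unit_normal[OF p tang(1)[of u]] by (simp add: H_def ip_def Let_def c_def[symmetric] diff tang)
  qed
  ultimately have "range L = H"
    using subspace_dim_equal[OF linear_subspace_image[OF linL subspace_UNIV] H] by blast
  moreover have "w c \<in> H" using orth by (simp add: H_def ip_def Let_def c_def)
  ultimately obtain u where u: "w c = L u" by blast
  have "differential S M F p (tangent_of S p s u) = w"
    by (rule tangent_space_eqI[OF mfds(2) differential_in_tangent_space[OF mfds p] w c])
       (simp add: diff tang u)
  with tang(1) that show ?thesis by blast
qed

text \<open>At a right angle the normal component of \<open>V\<close> is zero, so \<open>V\<close> is its own tangential component.\<close>

lemma tangential_part_eq: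
  assumes p: "p \<in> points S" and V: "V p \<in> tangent_space M (F p)"
    and angle: "ip M (F p) (V p) (N p) = 0" "\<theta> p = pi / 2"
  shows "tangential_part S M F N V \<theta> p \<in> tangent_space S p"
    and "differential S M F p (tangential_part S M F N V \<theta> p) = V p"
proof -
  obtain u where u: "u \<in> tangent_space S p" "differential S M F p u = V p"
    using orthogonal_to_normal_is_tangential[OF p V angle(1)] .
  have "cos (\<theta> p) = 0" unfolding angle(2) by simp
  hence "tangential_part S M F N V \<theta> p = u"
    unfolding tangential_part_def
    by (intro the_equality) (use u differential_inj[OF p] in auto)
  with u show "tangential_part S M F N V \<theta> p \<in> tangent_space S p"
    and "differential S M F p (tangential_part S M F N V \<theta> p) = V p" by simp_all
qed

lemma shape_operator_eqI:
  assumes p: "p \<in> points S" and w: "w \<in> tangent_space S p"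
    and eq: "differential S M F p w = (\<lambda>c. - cov_deriv S M \<Gamma> F p v N c)"
  shows "shape_operator S M \<Gamma> F N p v = w"
  unfolding shape_operator_def
  by (rule the_equality) (use w eq differential_inj[OF p] in auto)

text \<open>Differentiating \<open>\<langle>N, N\<rangle> = 1\<close> shows that the derivative of the normal is tangential.\<close>

lemma shape_operator_tangential:
  assumes lc: "levi_civita M \<Gamma>" and p: "p \<in> points S"
  shows "shape_operator S M \<Gamma> F N p v \<in> tangent_space S p"
    and "differential S M F p (shape_operator S M \<Gamma> F N p v) = (\<lambda>c. - cov_deriv S M \<Gamma> F p v N c)"
proof -
  have conn: "connection M \<Gamma>" "metric_compatible M \<Gamma>" using lc by (simp_all add: levi_civita_def)
  note Fp = hypersurface_points[OF hyp p]
  let ?D = "cov_deriv S M \<Gamma> F p v N"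
  have "dir_deriv S p v (\<lambda>q. ip M (F q) (N q) (N q)) = dir_deriv S p v (\<lambda>q. 1)"
    by (rule dir_deriv_cong[OF mfds(1) openin_topspace p unit_normal_unit])
  hence "ip M (F p) ?D (N p) = 0"
    using metric_compatible_along[OF R conn mfds(1,3) unit_normal_vector_field unit_normal_vector_field p, of v]
    by (simp add: dir_deriv_const ip_commute[OF R Fp, of "N p" ?D])
  hence orth: "ip M (F p) (\<lambda>c. - ?D c) (N p) = 0" by (simp add: ip_minus_left[OF R Fp])
  have "?D \<in> tangent_space M (F p)"
    by (rule cov_deriv_in_tangent_space[OF mfds conn(1) unit_normal_vector_field p])
  from tangent_space_scaleR[OF mfds(2) this, of "-1"]
  have tan: "(\<lambda>c. - ?D c) \<in> tangent_space M (F p)" by simp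
  obtain w where w: "w \<in> tangent_space S p" "differential S M F p w = (\<lambda>c. - ?D c)"
    using orthogonal_to_normal_is_tangential[OF p tan orth] .
  with shape_operator_eqI[OF p w]
  show "shape_operator S M \<Gamma> F N p v \<in> tangent_space S p"
    and "differential S M F p (shape_operator S M \<Gamma> F N p v) = (\<lambda>c. - ?D c)" by simp_all
qed

text \<open>Here \<open>\<langle>\<nabla>\<^sub>v V, N\<rangle>\<close> vanishes because \<open>\<nabla>\<^sub>v V\<close> is a combination of the tangent vectors \<open>v\<close> and \<open>V\<close>;
  differentiating \<open>\<langle>V, N\<rangle> = 0\<close> moves the derivative to the normal. The range of the shape operator is
  therefore orthogonal to \<open>V\<close>.\<close>

lemma shape_operator_orthogonal:
  assumes lc: "levi_civita M \<Gamma>" and V: "vector_field_along S M F V" and at: "anti_torqued S M \<Gamma> F V"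
    and perp: "\<And>q. q \<in> points S \<Longrightarrow> ip M (F q) (V q) (N q) = 0"
    and p: "p \<in> points S" and v: "v \<in> tangent_space S p"
  shows "ip M (F p) (differential S M F p (shape_operator S M \<Gamma> F N p v)) (V p) = 0"
proof -
  have conn: "connection M \<Gamma>" "metric_compatible M \<Gamma>" using lc by (simp_all add: levi_civita_def)
  note Fp = hypersurface_points[OF hyp p]
  obtain f where "\<forall>p\<in>points S. \<forall>v\<in>tangent_space S p. cov_deriv S M \<Gamma> F p v V =
      (\<lambda>c. f p *\<^sub>R (differential S M F p v c - ip M (F p) (differential S M F p v) (V p) *\<^sub>R V p c))"
    using anti_torqued_pointwise[OF mfds(1) at] by blast
  note cov = this[rule_format, OF p v]
  have "dir_deriv S p v (\<lambda>q. ip M (F q) (V q) (N q)) = dir_deriv S p v (\<lambda>q. 0)"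
    by (rule dir_deriv_cong[OF mfds(1) openin_topspace p perp])
  hence "ip M (F p) (cov_deriv S M \<Gamma> F p v V) (N p) + ip M (F p) (V p) (cov_deriv S M \<Gamma> F p v N) = 0"
    using metric_compatible_along[OF R conn mfds(1,3) V unit_normal_vector_field p, of v]
    by (simp add: dir_deriv_const)
  moreover have "ip M (F p) (cov_deriv S M \<Gamma> F p v V) (N p) = 0"
    unfolding cov by (simp add: ip_scaleR_left[OF R Fp] ip_diff_left[OF R Fp] ip_unit_normal[OF p v] perp[OF p])
  ultimately have "ip M (F p) (cov_deriv S M \<Gamma> F p v N) (V p) = 0"
    by (simp add: ip_commute[OF R Fp, of _ "V p"])
  thus ?thesis
    unfolding shape_operator_tangential(2)[OF lc p] by (simp add: ip_minus_left[OF R Fp])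
qed

text \<open>The correction term \<open>\<langle>v, V\<rangle> V\<close> in the anti-torqued condition disappears because \<open>v\<close> is tangent and
  \<open>V\<close> normal, which leaves \<open>\<nabla>\<^sub>v N = f v\<close> and the umbilicity factor \<open>- f\<close>.\<close>

lemma totally_umbilical_if_anti_torqued_normal:
  assumes at: "anti_torqued S M \<Gamma> F V" and VN: "\<And>p. p \<in> points S \<Longrightarrow> V p = N p"
  shows "totally_umbilical S M \<Gamma> F N"
proof -
  obtain f where f: "smooth_fun S (points S) f" and cov: "\<forall>p\<in>points S. \<forall>v\<in>tangent_space S p.
      cov_deriv S M \<Gamma> F p v V =
      (\<lambda>c. f p *\<^sub>R (differential S M F p v c - ip M (F p) (differential S M F p v) (V p) *\<^sub>R V p c))"
    using anti_torqued_pointwise[OF mfds(1) at] by blast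
  have "shape_operator S M \<Gamma> F N p v = (\<lambda>c. - f p *\<^sub>R v c)" if p: "p \<in> points S" and v: "v \<in> tangent_space S p" for p v
  proof (rule shape_operator_eqI[OF p tangent_space_scaleR[OF mfds(1) v]])
    have "cov_deriv S M \<Gamma> F p v N = cov_deriv S M \<Gamma> F p v V"
      by (rule cov_deriv_cong[OF mfds(1) p]) (simp add: VN)
    also have "\<dots> = (\<lambda>c. f p *\<^sub>R differential S M F p v c)"
      by (simp add: cov[rule_format, OF p v] VN[OF p] ip_unit_normal[OF p v])
    finally show "differential S M F p (\<lambda>c. - f p *\<^sub>R v c) = (\<lambda>c. - cov_deriv S M \<Gamma> F p v N c)"
      using differential_scaleR[OF mfds p, of "- f p" v] by simp
  qed
  thus ?thesis
    unfolding totally_umbilical_def using smooth_fun_uminus[OF mfds(1) f] by blast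
qed

end

section \<open>Curves in a hypersurface\<close>

lemma smooth_curve_in_points: "smooth_curve S I \<gamma> \<Longrightarrow> t \<in> I \<Longrightarrow> \<gamma> t \<in> points S"
  by (auto simp: smooth_curve_def continuous_map_def)

context
  fixes S :: "('s, 'k::euclidean_space, 'y) mfd_scheme"
    and M :: "('m, 'e::euclidean_space, 'z) mfd_scheme"
    and F :: "'s \<Rightarrow> 'm" and I :: "real set" and \<gamma> :: "real \<Rightarrow> 's"
  assumes S: "smooth_manifold S" and M: "smooth_manifold M" and F: "smooth_map S M F"
    and \<gamma>: "smooth_curve S I \<gamma>"
begin

lemma open_curve_preimage:
  assumes "openin (mtop S) U"
  shows "open {t \<in> I. \<gamma> t \<in> U}"
proof -
  have "openin (top_of_set I) {t \<in> topspace (top_of_set I). \<gamma> t \<in> U}"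
    using \<gamma> assms by (intro openin_continuous_map_preimage) (auto simp: smooth_curve_def)
  thus ?thesis using \<gamma> by (simp add: smooth_curve_def openin_open_eq)
qed

lemma smooth_curve_compose: "smooth_curve M I (F \<circ> \<gamma>)"
  unfolding smooth_curve_def
proof (intro conjI ballI)
  show "open I" "is_interval I" using \<gamma> by (simp_all add: smooth_curve_def)
  show "continuous_map (top_of_set I) (mtop M) (F \<circ> \<gamma>)"
    using \<gamma> F by (auto simp: smooth_curve_def smooth_map_def intro: continuous_map_compose)
  fix c assume c: "c \<in> atlas M"
  let ?Q = "{q \<in> points S. F q \<in> dom_of c}"
  show "smooth_on {t \<in> I. (F \<circ> \<gamma>) t \<in> dom_of c} (coord c \<circ> (F \<circ> \<gamma>))"
  proof (rule smooth_on_local)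
    fix t assume "t \<in> {t \<in> I. (F \<circ> \<gamma>) t \<in> dom_of c}"
    hence t: "t \<in> I" "F (\<gamma> t) \<in> dom_of c" "\<gamma> t \<in> points S" using smooth_curve_in_points[OF \<gamma>] by auto
    define s where "s = some_chart S (\<gamma> t)"
    have s: "s \<in> atlas S" "\<gamma> t \<in> dom_of s" using t(3) S by (simp_all add: s_def)
    let ?U = "{t \<in> I. \<gamma> t \<in> dom_of s \<inter> ?Q}"
    have U: "open ?U"
      by (rule open_curve_preimage[OF openin_Int[OF openin_dom[OF S s(1)] openin_preimage_dom[OF F M c]]])
    have "smooth_on ?U ((coord c \<circ> F \<circ> inv_coord s) \<circ> (coord s \<circ> \<gamma>))"
    proof (rule smooth_on_compose[OF _ _ U])
      show "smooth_on ?U (coord s \<circ> \<gamma>)"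
        by (rule smooth_on_subset[of "{t \<in> I. \<gamma> t \<in> dom_of s}"])
           (use \<gamma> s(1) in \<open>simp_all add: smooth_curve_def subset_iff\<close>)
      show "smooth_on (coord s ` (dom_of s \<inter> ?Q)) (coord c \<circ> F \<circ> inv_coord s)"
        using F c s(1) by (simp add: smooth_map_def smooth_fun_def)
    qed auto
    hence "smooth_on ?U (coord c \<circ> (F \<circ> \<gamma>))"
      by (rule smooth_on_cong[OF U]) (use inv_coord_coord[OF S s(1)] in simp)
    thus "\<exists>U. open U \<and> t \<in> U \<and> smooth_on U (coord c \<circ> (F \<circ> \<gamma>))"
      using U t s(2) by blast
  qed
qed

lemma has_vector_derivative_along_curve:
  assumes t: "t \<in> I" and h: "smooth_fun S U h" "\<gamma> t \<in> U"
  shows "(h \<circ> \<gamma> has_vector_derivative dir_deriv S (\<gamma> t) (velocity S \<gamma> t) h) (at t)"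
proof -
  note p = smooth_curve_in_points[OF \<gamma> t]
  define s where "s = some_chart S (\<gamma> t)"
  have s: "s \<in> atlas S" "\<gamma> t \<in> dom_of s" "s \<in> charts_at S (\<gamma> t)"
    using p S by (simp_all add: s_def some_chart_in)
  let ?J = "{t \<in> I. \<gamma> t \<in> dom_of s}"
  have J: "open ?J" "t \<in> ?J" using open_curve_preimage[OF openin_dom[OF S s(1)]] t s by auto
  have "((coord s \<circ> \<gamma>) has_derivative frechet_derivative (coord s \<circ> \<gamma>) (at t)) (at t)"
    by (rule smooth_on_has_derivative[OF _ J(2)]) (use \<gamma> s(1) in \<open>simp add: smooth_curve_def\<close>)
  hence "(coord s \<circ> \<gamma>) differentiable (at t)" by (rule differentiableI)
  hence "((coord s \<circ> \<gamma>) has_vector_derivative velocity S \<gamma> t s) (at t)"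
    using s(3) by (simp add: velocity_def vector_derivative_works)
  moreover have "(h \<circ> inv_coord s has_derivative frechet_derivative (h \<circ> inv_coord s) (at (coord s (\<gamma> t)))) (at ((coord s \<circ> \<gamma>) t))"
    using smooth_fun_has_derivative[OF S h p] by (simp add: s_def)
  ultimately have "((h \<circ> inv_coord s) \<circ> (coord s \<circ> \<gamma>) has_vector_derivative
      frechet_derivative (h \<circ> inv_coord s) (at (coord s (\<gamma> t))) (velocity S \<gamma> t s)) (at t)"
    by (rule vector_derivative_diff_chain_within[where S = UNIV, simplified, OF _ has_derivative_at_withinI])
  hence "(h \<circ> \<gamma> has_vector_derivative frechet_derivative (h \<circ> inv_coord s) (at (coord s (\<gamma> t))) (velocity S \<gamma> t s)) (at t)"
    by (rule has_vector_derivative_transform_within_open[OF _ J]) (use inv_coord_coord[OF S s(1)] in simp)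
  thus ?thesis by (simp add: dir_deriv_def Let_def s_def)
qed

lemma velocity_compose:
  assumes t: "t \<in> I"
  shows "velocity M (F \<circ> \<gamma>) t = differential S M F (\<gamma> t) (velocity S \<gamma> t)"
proof
  fix c
  show "velocity M (F \<circ> \<gamma>) t c = differential S M F (\<gamma> t) (velocity S \<gamma> t) c"
  proof (cases "c \<in> charts_at M (F (\<gamma> t))")
    case True
    have "(coord c \<circ> F \<circ> \<gamma> has_vector_derivative dir_deriv S (\<gamma> t) (velocity S \<gamma> t) (coord c \<circ> F)) (at t)"
      by (rule has_vector_derivative_along_curve[OF t, of "{q \<in> points S. F q \<in> dom_of c}"])
         (use F True smooth_curve_in_points[OF \<gamma> t] in \<open>simp_all add: smooth_map_def charts_at_def\<close>)
    from vector_derivative_at[OF this] True show ?thesis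
      by (simp add: velocity_def differential_def o_assoc)
  qed (simp add: velocity_def differential_def)
qed

text \<open>The velocity of the image curve is a vector field along \<open>F\<close> evaluated on the curve, so its
  covariant derivative along the curve can be computed from that field.\<close>

lemma acceleration_compose:
  assumes V: "vector_field_along S M F V"
    and vel: "\<And>t. t \<in> I \<Longrightarrow> differential S M F (\<gamma> t) (velocity S \<gamma> t) = V (\<gamma> t)"
    and t: "t \<in> I"
  shows "acceleration M \<Gamma> (F \<circ> \<gamma>) t = cov_deriv S M \<Gamma> F (\<gamma> t) (velocity S \<gamma> t) V"
proof
  fix c
  note p = smooth_curve_in_points[OF \<gamma> t]
  show "acceleration M \<Gamma> (F \<circ> \<gamma>) t c = cov_deriv S M \<Gamma> F (\<gamma> t) (velocity S \<gamma> t) V c"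
  proof (cases "c \<in> charts_at M (F (\<gamma> t))")
    case True
    have "((\<lambda>q. V q c) \<circ> \<gamma> has_vector_derivative dir_deriv S (\<gamma> t) (velocity S \<gamma> t) (\<lambda>q. V q c)) (at t)"
      by (rule has_vector_derivative_along_curve[OF t, of "{q \<in> points S. F q \<in> dom_of c}"])
         (use V True p in \<open>simp_all add: vector_field_along_def charts_at_def\<close>)
    moreover have "open I" using \<gamma> by (simp add: smooth_curve_def)
    ultimately have "((\<lambda>s. velocity M (F \<circ> \<gamma>) s c) has_vector_derivative
        dir_deriv S (\<gamma> t) (velocity S \<gamma> t) (\<lambda>q. V q c)) (at t)"
      by (rule has_vector_derivative_transform_within_open[OF _ _ t]) (simp add: velocity_compose vel)
    from vector_derivative_at[OF this] True show ?thesis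
      by (simp add: acceleration_def cov_deriv_def velocity_compose[OF t] vel[OF t])
  qed (simp add: acceleration_def cov_deriv_def)
qed

end

section \<open>Anti-torqued fields on hypersurfaces of constant angle\<close>

text \<open>The functional vanishes on the columns of the matrix and hence on its range, so \<open>a\<close> is not in the
  range and the matrix is singular.\<close>

lemma det_eq_0_if_columns_in_kernel:
  fixes \<phi> :: "real ^ 'n \<Rightarrow> real"
  assumes "linear \<phi>" "\<phi> a \<noteq> 0" "\<And>x. \<phi> (A x) = 0"
  shows "det (matrix A) = 0"
proof (rule ccontr)
  assume "det (matrix A) \<noteq> 0"
  hence "invertible (matrix A)" by (simp add: invertible_det_nz)
  then obtain B where B: "matrix A ** B = mat 1" by (auto simp: invertible_def)
  have "a = matrix A *v (B *v a)" by (simp add: matrix_vector_mul_assoc B)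
  also have "\<dots> = (\<Sum>i\<in>UNIV. (B *v a) $ i *\<^sub>R A (axis i 1))"
    by (simp add: matrix_mult_sum matrix_def column_def scalar_mult_eq_scaleR)
  finally have "\<phi> a = (\<Sum>i\<in>UNIV. (B *v a) $ i *\<^sub>R \<phi> (A (axis i 1)))"
    using assms(1) by (metis (no_types, lifting) linear_scale linear_sum sum.cong)
  with assms(2,3) show False by simp
qed

theorem proposition3p9:
  fixes M :: "('m, 'e::euclidean_space) riem_mfd"
    and \<Gamma> :: "('m, 'e) christoffel"
    and S :: "('s, real ^ 'n) mfd"
    and F :: "'s \<Rightarrow> 'm"
    and N V :: "'s \<Rightarrow> ('m, 'e) tangent"
    and \<theta> :: "'s \<Rightarrow> real"
  assumes "riemannian_manifold M"
    and "levi_civita M \<Gamma>"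
    and "pa_hypersurface S M F N V \<theta>"
    and "anti_torqued S M \<Gamma> F V"
  shows "((\<forall>p\<in>points S. \<theta> p = pi / 2) \<longrightarrow>
            (\<forall>I \<gamma>. integral_curve S (tangential_part S M F N V \<theta>) I \<gamma> \<longrightarrow> geodesic M \<Gamma> I (F \<circ> \<gamma>)) \<and>
            (\<forall>p\<in>points S. tangent_det S p (shape_operator S M \<Gamma> F N p) = 0)) \<and>
         ((\<forall>p\<in>points S. \<theta> p = 0) \<longrightarrow> totally_umbilical S M \<Gamma> F N)"
proof -
  note R = assms(1) and lc = assms(2) and at = assms(4)
  have hyp: "hypersurface S M F" and N: "unit_normal S M F N"
    and V: "vector_field_along S M F V" and V1: "\<And>p. p \<in> points S \<Longrightarrow> ip M (F p) (V p) (V p) = 1"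
    and angle: "\<And>p. p \<in> points S \<Longrightarrow> ip M (F p) (V p) (N p) = cos (\<theta> p)"
    using assms(3) by (auto simp: pa_hypersurface_def unit_field_along_def)
  note mfds = hypersurface_smooth_manifold[OF hyp] riemannian_smooth_manifold[OF R] hypersurface_smooth_map[OF hyp]
  note tan_V = vector_field_along_in_tangent_space[OF V]
  let ?T = "tangential_part S M F N V \<theta>"
  have "geodesic M \<Gamma> I (F \<circ> \<gamma>)"
    if \<theta>: "\<forall>p\<in>points S. \<theta> p = pi / 2" and int: "integral_curve S ?T I \<gamma>" for I \<gamma>
  proof -
    have \<gamma>: "smooth_curve S I \<gamma>" and vel: "\<And>t. t \<in> I \<Longrightarrow> velocity S \<gamma> t = ?T (\<gamma> t)"
      using int by (auto simp: integral_curve_def)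
    note pts = smooth_curve_in_points[OF \<gamma>]
    have T: "?T p \<in> tangent_space S p" "differential S M F p (?T p) = V p" if p: "p \<in> points S" for p
      using tangential_part_eq[OF R hyp N p, of V \<theta>] tan_V[OF p] angle[OF p] \<theta> p by simp_all
    have "acceleration M \<Gamma> (F \<circ> \<gamma>) t c = 0" if t: "t \<in> I" for t c
    proof -
      have "acceleration M \<Gamma> (F \<circ> \<gamma>) t = cov_deriv S M \<Gamma> F (\<gamma> t) (?T (\<gamma> t)) V"
        using acceleration_compose[OF mfds \<gamma> V _ t] vel T(2)[OF pts] t by simp
      also
      \<comment> \<open>\<open>dF T = V\<close> has length one, so \<open>f (V - \<langle>V, V\<rangle> V)\<close> is zero\<close>
      obtain f where "\<forall>p\<in>points S. \<forall>v\<in>tangent_space S p. cov_deriv S M \<Gamma> F p v V =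
          (\<lambda>c. f p *\<^sub>R (differential S M F p v c - ip M (F p) (differential S M F p v) (V p) *\<^sub>R V p c))"
        using anti_torqued_pointwise[OF mfds(1) at] by blast
      note this[rule_format, OF pts[OF t] T(1)[OF pts[OF t]]]
      finally show ?thesis by (simp add: T(2)[OF pts[OF t]] V1[OF pts[OF t]])
    qed
    thus ?thesis
      using smooth_curve_compose[OF mfds \<gamma>] by (simp add: geodesic_def)
  qed
  moreover have "tangent_det S p (shape_operator S M \<Gamma> F N p) = 0"
    if \<theta>: "\<forall>p\<in>points S. \<theta> p = pi / 2" and p: "p \<in> points S" for p
  proof -
    define s where "s = some_chart S p"
    define c where "c = some_chart M (F p)"
    have s: "s \<in> charts_at S p" unfolding s_def by (rule some_chart_in[OF mfds(1) p])
    have c: "c \<in> charts_at M (F p)"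
      unfolding c_def by (rule some_chart_in[OF mfds(2) hypersurface_points[OF hyp p]])
    define L where "L = frechet_derivative (coord c \<circ> F \<circ> inv_coord s) (at (coord s p))"
    \<comment> \<open>the functional \<open>w \<mapsto> \<langle>dF w, V\<rangle>\<close> in coordinates; it is \<open>1\<close> at \<open>T\<close> and \<open>0\<close> on the range of the shape operator\<close>
    define \<phi> where "\<phi> = (\<lambda>u. gcomp M c (F p) (L u) (V p c))"
    have "linear L"
      using has_derivative_linear[OF smooth_map_coord_has_derivative[OF mfds p c]] by (simp add: L_def s_def)
    hence "linear \<phi>"
      using gcomp_bilinear[OF R c] linear_compose[of L "\<lambda>x. gcomp M c (F p) x (V p c)"]
      by (simp add: \<phi>_def bilinear_def o_def)
    have \<phi>: "\<phi> (w s) = ip M (F p) (differential S M F p w) (V p)" for w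
      by (simp add: \<phi>_def L_def s_def ip_def Let_def c_def[symmetric] differential_eq[OF mfds c])
    have "\<phi> (?T p s) = 1"
      unfolding \<phi> using tangential_part_eq[OF R hyp N p, of V \<theta>] tan_V[OF p] angle[OF p] \<theta> p V1[OF p] by simp
    moreover have "\<phi> (shape_operator S M \<Gamma> F N p (tangent_of S p s u) s) = 0" for u
      unfolding \<phi>
      by (rule shape_operator_orthogonal[OF R hyp N lc V at _ p tangent_of_in_tangent_space[OF mfds(1) s]])
         (use angle \<theta> in simp)
    ultimately show ?thesis
      unfolding tangent_det_def Let_def s_def[symmetric]
      by (intro det_eq_0_if_columns_in_kernel[OF \<open>linear \<phi>\<close>, of "?T p s"]) simp_all
  qed
  moreover have "totally_umbilical S M \<Gamma> F N" if \<theta>: "\<forall>p\<in>points S. \<theta> p = 0"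
  proof (rule totally_umbilical_if_anti_torqued_normal[OF R hyp N at])
    fix p assume p: "p \<in> points S"
    show "V p = N p"
      by (rule unit_vectors_eqI[OF R hypersurface_points[OF hyp p] tan_V[OF p]
            vector_field_along_in_tangent_space[OF unit_normal_vector_field[OF R hyp N] p]])
         (use V1[OF p] unit_normal_unit[OF R hyp N p] angle[OF p] \<theta> p in simp_all)
  qed
  ultimately show ?thesis by blast
qed

end
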